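(* Suppose that $q=1+3b^2$ is a prime power with $b$ an even integer, and that $2$ is a cube in $\mathbb{F}_q$. Let $\omega$ be a primitive element of $\mathbb{F}_q$, $C_0=\langle\omega^6\rangle\le\mathbb{F}_q^*$, $C_3=\omega^3C_0$, let $H$ be the additive group of $\mathbb{F}_q$, $K=\langle\rho\rangle\le\mathrm{Aut}(H)$ with $\rho(x)=\omega^6x$, and $G=H\rtimes K$. Then $W=\{(-1+c,\phi): c\in C_3,\ \phi\in K\}\subseteq G$ is the connection set of a directed strongly regular Cayley graph on $G$; that is, $\mathrm{Cay}(G,W)$ is a directed strongly regular graph, with parameters $$(v,k,\lambda,\mu,t)=\left(\frac{(q-1)q}{6},\ \frac{(q-1)^2}{36},\ \frac{(q-1)^2}{216}-\frac{q-1}{36},\ \frac{(q-1)^2}{216},\ \frac{(q-1)^2}{216}\right).$$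
   Context: $G=H\rtimes K$ is the set $H\times K$ with operation $(h,\phi)(h',\phi')=(h+\phi(h'),\phi\phi')$. For a finite group $G$ and $S\subseteq G$, $\mathrm{Cay}(G,S)$ is the digraph with vertex set $G$ and an arc $(x,y)$ whenever $yx^{-1}\in S$. A directed strongly regular graph with parameters $(v,k,\lambda,\mu,t)$ is a finite directed graph $(V,E)$ without loops, $|V|=v$, such that: (1) every vertex has exactly $k$ out-neighbours and exactly $k$ in-neighbours; (2) for every vertex $x$ there are exactly $t$ vertices $y$ with $(x,y),(y,x)\in E$; (3) for any distinct vertices $x,y$ the number of $z$ with $(x,z),(z,y)\in E$ is $\lambda$ if $(x,y)\in E$, and $\mu$ otherwise. *)

theory Defs
  imports
    "HOL-Library.Cardinality"
    "HOL-Algebra.Algebraic_Closure_Type"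
    "HOL-Algebra.Bij"
    "HOL-Algebra.Generated_Groups"
    "HOL-Algebra.Multiplicative_Group"
    "HOL-Number_Theory.Prime_Powers"
    "Graph_Theory.Pair_Digraph"
begin

text \<open>
  A finite field is a type of class \<open>{field, finite}\<close>; \<open>field_rec\<close> is the same field as a
  record, whose additive group is \<open>add_monoid field_rec\<close>.  The qualifier below is needed
  because \<open>HOL-Algebra\<close> defines \<open>mult_of\<close> twice, with the same equation.
\<close>

abbreviation field_rec :: "'a::field ring" where
  "field_rec \<equiv> ring_of_type_algebra"

abbreviation field_units :: "'a::field monoid" where
  "field_units \<equiv> Multiplicative_Group.mult_of field_rec"

definition primitive_element :: "'a::field \<Rightarrow> bool" where
  "primitive_element \<omega> \<longleftrightarrow>
     \<omega> \<in> carrier field_units \<and>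
     generate field_units {\<omega>} = carrier field_units"

text \<open>
  The second argument is a set of automorphisms, intended to be a subgroup of
  \<open>AutoGroup H\<close>; it acts on \<open>H\<close> by evaluation.
\<close>

definition semidirect :: "('a, 'b) monoid_scheme \<Rightarrow> ('a \<Rightarrow> 'a) set \<Rightarrow> ('a \<times> ('a \<Rightarrow> 'a)) monoid" where
  "semidirect H K =
     \<lparr>carrier = carrier H \<times> K,
      monoid.mult = (\<lambda>(h, \<phi>) (h', \<phi>'). (h \<otimes>\<^bsub>H\<^esub> \<phi> h', \<phi> \<otimes>\<^bsub>AutoGroup H\<^esub> \<phi>')),
      monoid.one = (\<one>\<^bsub>H\<^esub>, \<one>\<^bsub>AutoGroup H\<^esub>)\<rparr>"

lemma (in group) group_semidirect:
  assumes K: "subgroup K (AutoGroup G)"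
  shows "group (semidirect G K)"
proof -
  interpret A: group "AutoGroup G" by (rule AutoGroup)
  have aut: "\<phi> \<in> hom G G" "\<phi> \<in> Bij (carrier G)" if "\<phi> \<in> K" for \<phi>
    using subgroup.subset[OF K] that by (auto simp: AutoGroup_def auto_def)
  have carrier_A: "\<phi> \<in> carrier (AutoGroup G)" if "\<phi> \<in> K" for \<phi>
    using subgroup.subset[OF K] that by blast
  have closed: "\<phi> x \<in> carrier G" if "\<phi> \<in> K" "x \<in> carrier G" for \<phi> x
    using aut(1)[OF that(1)] that(2) by (auto simp: hom_def)
  have hom: "\<phi> (x \<otimes> y) = \<phi> x \<otimes> \<phi> y" if "\<phi> \<in> K" "x \<in> carrier G" "y \<in> carrier G" for \<phi> x y
    using aut(1)[OF that(1)] that by (auto simp: hom_def)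
  have comp: "(\<phi> \<otimes>\<^bsub>AutoGroup G\<^esub> \<psi>) x = \<phi> (\<psi> x)"
    if "\<phi> \<in> K" "\<psi> \<in> K" "x \<in> carrier G" for \<phi> \<psi> x
    using aut(2)[OF that(1)] aut(2)[OF that(2)] that(3)
    by (simp add: AutoGroup_def BijGroup_def compose_def)
  have one_app: "\<one>\<^bsub>AutoGroup G\<^esub> x = x" if "x \<in> carrier G" for x
    using that by (simp add: AutoGroup_def BijGroup_def)
  note simps = semidirect_def closed hom comp one_app m_assoc carrier_A
    subgroup.m_closed[OF K] subgroup.one_closed[OF K] subgroup.m_inv_closed[OF K]
  show ?thesis
  proof (rule groupI, goal_cases)
    case (5 x)
    then obtain h \<phi> where x: "x = (h, \<phi>)" "h \<in> carrier G" "\<phi> \<in> K"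
      by (auto simp: semidirect_def)
    let ?\<psi> = "inv\<^bsub>AutoGroup G\<^esub> \<phi>"
    have \<psi>: "?\<psi> \<in> K"
      using x(3) by (rule subgroup.m_inv_closed[OF K])
    show ?case
      by (rule bexI[of _ "(inv (?\<psi> h), ?\<psi>)"]) (use x \<psi> in \<open>auto simp: simps\<close>)
  qed (auto simp: simps A.m_assoc)
qed

definition cayley :: "('a, 'b) monoid_scheme \<Rightarrow> 'a set \<Rightarrow> 'a pair_pre_digraph" where
  "cayley G S =
     \<lparr>pverts = carrier G,
      parcs = {(x, y). x \<in> carrier G \<and> y \<in> carrier G \<and> y \<otimes>\<^bsub>G\<^esub> inv\<^bsub>G\<^esub> x \<in> S}\<rparr>"

text \<open>The locale \<open>pair_digraph\<close> describes finite digraphs without loops or multiple arcs.\<close>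

definition directed_strongly_regular ::
    "'a pair_pre_digraph \<Rightarrow> nat \<Rightarrow> nat \<Rightarrow> nat \<Rightarrow> nat \<Rightarrow> nat \<Rightarrow> bool" where
  "directed_strongly_regular D v k l m t \<longleftrightarrow>
     pair_digraph D \<and> card (pverts D) = v \<and>
     (\<forall>x\<in>pverts D. card {y \<in> pverts D. (x, y) \<in> parcs D} = k \<and>
                   card {y \<in> pverts D. (y, x) \<in> parcs D} = k) \<and>
     (\<forall>x\<in>pverts D. card {y \<in> pverts D. (x, y) \<in> parcs D \<and> (y, x) \<in> parcs D} = t) \<and>
     (\<forall>x\<in>pverts D. \<forall>y\<in>pverts D. x \<noteq> y \<longrightarrow>
        card {z \<in> pverts D. (x, z) \<in> parcs D \<and> (z, y) \<in> parcs D} =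
          (if (x, y) \<in> parcs D then l else m))"

end

theory Submission
  imports Defs "HOL-Number_Theory.Residues"
begin

text \<open>
  Put \<open>S = -1 + C\<^sub>3\<close>, so that \<open>W = S \<times> K\<close>, where \<open>K\<close> acts as multiplication by \<open>C\<^sub>0\<close>.  If
  every coset \<open>C\<^sub>i\<close> of \<open>C\<^sub>0\<close> meets \<open>S\<close> in the same number \<open>f = (q - 1)/36\<close> of elements, then an
  element \<open>(h, \<phi>)\<close> of \<open>G\<close> is a product of two elements of \<open>W\<close> in \<open>f \<cdot> |S - {h}|\<close> ways, which gives all the
  parameters.  Uniformity of the cyclotomic numbers \<open>|S \<inter> C\<^sub>i|\<close> follows from the symmetries of cyclotomic
  numbers, from counting solutions of \<open>u(1 - u) = v\<close> (where \<open>2\<close> being a cube removes the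
  twist by \<open>4\<close>), and from the fact that the Jacobi sum of a cubic and the quadratic character has real
  part \<open>-1\<close>.  The latter holds because this Jacobi sum \<open>A + B\<surd>-3\<close> has norm \<open>q = 1 + 3b\<^sup>2\<close> with \<open>A\<close> prime to
  the characteristic, which forces \<open>A = \<plusminus>1\<close>, and \<open>A \<equiv> -1 (mod 3)\<close>.
\<close>

section \<open>Cyclotomic classes\<close>

locale finite_field_generator =
  fixes \<omega> :: "'a::{field,finite}" and N :: nat
  assumes card_eq_Suc_N: "CARD('a) = Suc N"
    and gen_nonzero: "\<omega> \<noteq> 0"
    and gen: "x \<noteq> 0 \<Longrightarrow> \<exists>k. x = \<omega> ^ k"
begin

lemma N_pos: "N > 0"
  using card_mono[of "UNIV::'a set" "{0, 1}"] card_eq_Suc_N by simp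

lemma card_units: "card {x::'a. x \<noteq> 0} = N"
proof -
  have "{x::'a. x \<noteq> 0} = UNIV - {0}" by auto
  then show ?thesis by (simp add: card_Diff_singleton card_eq_Suc_N)
qed

text \<open>Multiplication by \<open>x\<close> permutes the nonzero elements, so the factor
  \<open>x ^ N\<close> leaves their product unchanged.\<close>

lemma power_N:
  assumes "x \<noteq> (0::'a)"
  shows "x ^ N = 1"
proof -
  have "(\<Prod>y\<in>{y::'a. y \<noteq> 0}. y) = (\<Prod>y\<in>{y::'a. y \<noteq> 0}. x * y)"
    by (rule prod.reindex_bij_witness[where i = "\<lambda>y. x * y" and j = "\<lambda>y. y / x"])
       (use assms in auto)
  also have "\<dots> = x ^ N * (\<Prod>y\<in>{y::'a. y \<noteq> 0}. y)"
    by (simp add: prod.distrib card_units)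
  finally show ?thesis by simp
qed

lemma gen_power_mod: "\<omega> ^ (k mod N) = \<omega> ^ k"
proof -
  have "\<omega> ^ k = \<omega> ^ (N * (k div N) + k mod N)" by simp
  also have "\<dots> = \<omega> ^ (k mod N)"
    unfolding power_add power_mult power_N[OF gen_nonzero] by simp
  finally show ?thesis by simp
qed

lemma gen_power_image: "(\<lambda>k. \<omega> ^ k) ` {..<N} = {x. x \<noteq> 0}"
proof
  show "{x. x \<noteq> 0} \<subseteq> (\<lambda>k. \<omega> ^ k) ` {..<N}"
  proof
    fix x assume "x \<in> {x::'a. x \<noteq> 0}"
    then obtain k where "x = \<omega> ^ (k mod N)" using gen gen_power_mod by auto
    then show "x \<in> (\<lambda>k. \<omega> ^ k) ` {..<N}" using N_pos by auto
  qed
qed (use gen_nonzero in auto)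

text \<open>The \<open>N\<close> powers with exponents below \<open>N\<close> reach all
  \<open>N\<close> nonzero elements, hence they are distinct.\<close>

lemma gen_power_eq_iff: "\<omega> ^ k = \<omega> ^ l \<longleftrightarrow> [k = l] (mod N)"
proof -
  have "inj_on (\<lambda>k. \<omega> ^ k) {..<N}"
    by (rule eq_card_imp_inj_on) (simp_all only: gen_power_image card_units finite_lessThan card_lessThan)
  then have "\<omega> ^ (k mod N) = \<omega> ^ (l mod N) \<longleftrightarrow> k mod N = l mod N"
    using N_pos by (auto simp: inj_on_def)
  then show ?thesis by (simp only: gen_power_mod cong_def)
qed

text \<open>The discrete logarithm to base \<omega>, meaningful modulo \<open>N\<close> and for
  nonzero arguments only. Integer values let indices be subtracted and negated.\<close>

definition ind :: "'a \<Rightarrow> int" where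
  "ind x = int (LEAST k. x = \<omega> ^ k)"

lemma gen_power_ind: "x \<noteq> 0 \<Longrightarrow> \<omega> ^ nat (ind x) = x"
  unfolding ind_def nat_int using LeastI_ex[OF gen] by metis

lemma ind_nonneg: "ind x \<ge> 0"
  by (simp add: ind_def)

lemma ind_gen_power: "[ind (\<omega> ^ k) = int k] (mod int N)"
proof -
  have "\<omega> ^ nat (ind (\<omega> ^ k)) = \<omega> ^ k" using gen_nonzero by (intro gen_power_ind) auto
  then have "[int (nat (ind (\<omega> ^ k))) = int k] (mod int N)"
    unfolding gen_power_eq_iff cong_int_iff .
  then show ?thesis by (simp add: ind_nonneg)
qed

lemma ind_mult:
  assumes "x \<noteq> 0" "y \<noteq> 0"
  shows "[ind (x * y) = ind x + ind y] (mod int N)"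
proof -
  have "\<omega> ^ (nat (ind x) + nat (ind y)) = x * y"
    using assms by (simp add: power_add gen_power_ind)
  with ind_gen_power[of "nat (ind x) + nat (ind y)"] show ?thesis
    by (simp add: ind_nonneg)
qed

text \<open>For \<open>e dvd N\<close> these are the cosets of the group of nonzero
  \<open>e\<close>-th powers; the index is any integer, read modulo \<open>e\<close>.\<close>

definition C :: "nat \<Rightarrow> int \<Rightarrow> 'a set" where
  "C e i = {x. x \<noteq> 0 \<and> [ind x = i] (mod int e)}"

lemma C_cong: "[i = j] (mod int e) \<Longrightarrow> C e i = C e j"
  unfolding C_def by (auto intro: cong_trans cong_sym)

lemma C_nonzero: "x \<in> C e i \<Longrightarrow> x \<noteq> 0"
  by (simp add: C_def)

lemma C_unique:
  assumes "x \<in> C e i" "x \<in> C e j"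
  shows "[i = j] (mod int e)"
  using assms unfolding C_def by (auto intro: cong_trans cong_sym)

lemma C_ind: "x \<noteq> 0 \<Longrightarrow> x \<in> C e (ind x)"
  by (simp add: C_def)

context
  fixes e :: nat
  assumes e: "e dvd N"
begin

lemma e_pos: "e > 0"
  using e N_pos by (metis dvd_0_left gr0I less_irrefl)

lemma cong_N: "[i = j] (mod int N) \<Longrightarrow> [i = j] (mod int e)"
  using e by (auto intro: cong_dvd_modulus)

lemma C_mult:
  assumes "x \<in> C e i" "y \<in> C e j"
  shows "x * y \<in> C e (i + j)"
proof -
  have "[ind (x * y) = ind x + ind y] (mod int e)"
    using assms by (intro cong_N ind_mult) (auto simp: C_def)
  also have "[ind x + ind y = i + j] (mod int e)"
    using assms by (intro cong_add) (auto simp: C_def)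
  finally show ?thesis using assms by (simp add: C_def)
qed

lemma gen_power_in_C: "\<omega> ^ k \<in> C e (int k)"
  using cong_N[OF ind_gen_power] gen_nonzero by (simp add: C_def)

lemma one_in_C: "1 \<in> C e 0"
  using gen_power_in_C[of 0] by simp

lemma C_inverse:
  assumes "x \<in> C e i"
  shows "inverse x \<in> C e (- i)"
proof -
  have x: "x \<noteq> 0" using assms by (simp add: C_def)
  then have "inverse x \<in> C e (ind (inverse x))" by (intro C_ind) simp
  from C_mult[OF this assms] x have "1 \<in> C e (ind (inverse x) + i)" by simp
  from this one_in_C have "[ind (inverse x) + i = 0] (mod int e)" by (rule C_unique)
  then have "[ind (inverse x) = - i] (mod int e)"
    by (simp add: cong_iff_dvd_diff)
  with x show ?thesis by (simp add: C_def)
qed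

lemma C_divide: "x \<in> C e i \<Longrightarrow> y \<in> C e j \<Longrightarrow> x / y \<in> C e (i - j)"
  using C_mult[OF _ C_inverse] by (simp add: divide_inverse)

lemma C_power: "x \<in> C e i \<Longrightarrow> x ^ k \<in> C e (int k * i)"
  using C_mult[of x i "x ^ k" "int k * i" for k]
  by (induction k) (simp_all add: one_in_C algebra_simps)

lemma mult_in_C_iff:
  assumes "c \<in> C e j"
  shows "c * x \<in> C e i \<longleftrightarrow> x \<in> C e (i - j)"
proof
  assume "c * x \<in> C e i"
  then have "c * x / c \<in> C e (i - j)" using assms by (rule C_divide)
  then show "x \<in> C e (i - j)" using assms by (simp add: C_def)
next
  assume "x \<in> C e (i - j)"
  from C_mult[OF assms this] show "c * x \<in> C e i" by simp
qed

lemma C_ex: "\<exists>x. x \<in> C e i"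
proof -
  have "[int (nat (i mod int e)) = i] (mod int e)" using e_pos by (simp add: cong_def)
  then show ?thesis using gen_power_in_C[of "nat (i mod int e)"] C_cong by metis
qed

lemma bij_betw_C:
  assumes "c \<in> C e j"
  shows "bij_betw (\<lambda>x. c * x) (C e i) (C e (i + j))"
proof (rule bij_betwI[where g = "\<lambda>x. x / c"])
  show "(\<lambda>x. x / c) \<in> C e (i + j) \<rightarrow> C e i" using C_divide[OF _ assms] by force
qed (use assms mult_in_C_iff[OF assms] in \<open>auto simp: C_nonzero\<close>)

lemma sum_C: "(\<Sum>i=0..<int e. sum f (C e i)) = (\<Sum>x | x \<noteq> 0. f x)"
  for f :: "'a \<Rightarrow> 'b::comm_monoid_add"
proof -
  have "(\<Sum>x | x \<noteq> 0. f x) = sum f (\<Union>i\<in>{0..<int e}. C e i)"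
  proof (rule sum.cong)
    show "{x. x \<noteq> 0} = (\<Union>i\<in>{0..<int e}. C e i)"
    proof
      show "{x. x \<noteq> 0} \<subseteq> (\<Union>i\<in>{0..<int e}. C e i)"
        using e_pos by (auto simp: C_def intro!: bexI[of _ "ind _ mod int e"] simp: cong_def)
    qed (auto simp: C_def)
  qed simp
  also have "\<dots> = (\<Sum>i=0..<int e. sum f (C e i))"
  proof (rule sum.UNION_disjoint)
    show "\<forall>i\<in>{0..<int e}. \<forall>j\<in>{0..<int e}. i \<noteq> j \<longrightarrow> C e i \<inter> C e j = {}"
    proof (intro ballI impI)
      fix i j assume ij: "i \<in> {0..<int e}" "j \<in> {0..<int e}" "i \<noteq> j"
      have "x \<notin> C e j" if "x \<in> C e i" for x
        using cong_less_imp_eq_int[of i "int e" j] C_unique[OF that, of j] ij by auto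
      then show "C e i \<inter> C e j = {}" by auto
    qed
  qed auto
  finally show ?thesis by simp
qed

text \<open>Multiplication by an element of class \<open>i - j\<close> carries class
  \<open>j\<close> onto class \<open>i\<close>, so the classes that partition the nonzero elements
  have equal size.\<close>

lemma card_C: "e * card (C e i) = N"
proof -
  have eq: "card (C e j) = card (C e i)" for j
  proof -
    obtain c where "c \<in> C e (i - j)" using C_ex by blast
    from bij_betw_same_card[OF bij_betw_C[OF this, of j]] show ?thesis by simp
  qed
  have "N = (\<Sum>j=0..<int e. card (C e j))"
    using sum_C[of "\<lambda>_. 1::nat"] by (simp add: card_units)
  also have "\<dots> = (\<Sum>j=0..<int e. card (C e i))" by (rule sum.cong[OF refl eq])
  finally show ?thesis by simp
qed

lemma power_in_C: "x \<noteq> 0 \<Longrightarrow> x ^ e \<in> C e 0"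
  using C_power[OF C_ind, of x e] C_cong[of "int e * ind x" 0 e] by (simp add: cong_0_iff)

end

text \<open>The \<open>e\<close>-th roots of unity are the class \<open>C m 0\<close> with
  \<open>m = N / e\<close>, which has \<open>e\<close> elements; the roots of \<open>x\<close> are a
  translate of it.\<close>

lemma card_roots:
  assumes e: "e dvd N" and "x \<in> C e 0"
  shows "card {y. y ^ e = x} = e"
proof -
  obtain m where m: "N = e * m" using e by (elim dvdE)
  have m0: "m dvd N" "m > 0" using m N_pos by auto
  have one: "{y. y ^ e = 1} = C m 0"
  proof (rule Set.set_eqI)
    fix y
    show "y \<in> {y. y ^ e = 1} \<longleftrightarrow> y \<in> C m 0"
    proof (cases "y = 0")
      case False
      then have "y ^ e = 1 \<longleftrightarrow> \<omega> ^ (nat (ind y) * e) = \<omega> ^ 0"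
        by (simp add: power_mult gen_power_ind)
      also have "\<dots> \<longleftrightarrow> N dvd nat (ind y) * e"
        unfolding gen_power_eq_iff by (simp add: cong_0_iff)
      also have "\<dots> \<longleftrightarrow> m dvd nat (ind y)"
        unfolding m using e_pos[OF e] by (simp add: mult.commute)
      also have "\<dots> \<longleftrightarrow> int m dvd ind y"
        using ind_nonneg by (metis int_dvd_int_iff nat_0_le)
      finally show ?thesis using False by (simp add: C_def cong_0_iff)
    qed (use e_pos[OF e] in \<open>auto simp: C_def zero_power\<close>)
  qed
  have x: "x \<noteq> 0" "int e dvd ind x" using assms by (auto simp: C_def cong_0_iff)
  then have "e dvd nat (ind x)"
    using ind_nonneg by (metis int_dvd_int_iff nat_0_le)
  then obtain l where "nat (ind x) = l * e" by (auto simp: dvd_def mult.commute)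
  with gen_power_ind[OF x(1)] have z: "(\<omega> ^ l) ^ e = x" by (simp add: power_mult)
  have "bij_betw (\<lambda>y. \<omega> ^ l * y) {y. y ^ e = 1} {y. y ^ e = x}"
    by (rule bij_betwI[where g = "\<lambda>y. y / \<omega> ^ l"])
       (use z gen_nonzero x(1) in \<open>auto simp: power_mult_distrib power_divide\<close>)
  then have "card {y. y ^ e = x} = card (C m 0)"
    using bij_betw_same_card one by metis
  moreover have "m * card (C m 0) = e * m"
    using card_C[OF m0(1)] m by simp
  ultimately show ?thesis using m0 by simp
qed

text \<open>The map \<open>x ^ e\<close> hits 0 once and every element of \<open>C e 0\<close>
  exactly \<open>e\<close> times.\<close>

lemma sum_power:
  fixes f :: "'a \<Rightarrow> 'b::comm_semiring_1"
  assumes e: "e dvd N"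
  shows "(\<Sum>x\<in>UNIV. f (x ^ e)) = f 0 + of_nat e * sum f (C e 0)"
proof -
  have "(\<Sum>x\<in>UNIV. f (x ^ e)) = f (0 ^ e) + (\<Sum>x\<in>UNIV - {0}. f (x ^ e))"
    by (rule sum.remove) auto
  also have "(\<Sum>x\<in>UNIV - {0}. f (x ^ e)) = (\<Sum>y\<in>C e 0. \<Sum>x | x \<in> UNIV - {0} \<and> x ^ e = y. f (x ^ e))"
    by (rule sum.group[symmetric]) (auto intro: power_in_C[OF e])
  also have "\<dots> = (\<Sum>y\<in>C e 0. of_nat e * f y)"
  proof (rule sum.cong)
    fix y assume y: "y \<in> C e 0"
    then have *: "{x. x \<in> UNIV - {0} \<and> x ^ e = y} = {x. x ^ e = y}"
      using e_pos[OF e] by (auto simp: C_def)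
    have "(\<Sum>x | x \<in> UNIV - {0} \<and> x ^ e = y. f (x ^ e)) = (\<Sum>x | x ^ e = y. f y)"
      unfolding * by (rule sum.cong) auto
    then show "(\<Sum>x | x \<in> UNIV - {0} \<and> x ^ e = y. f (x ^ e)) = of_nat e * f y"
      by (simp add: card_roots[OF e y])
  qed simp
  finally show ?thesis using e_pos[OF e] by (simp add: sum_distrib_left zero_power)
qed

end

section \<open>The quadratic character and a cubic Jacobi sum\<close>

context finite_field_generator
begin

text \<open>The quadratic character. It is multiplicative once the parity of an index is well
  defined modulo \<open>N\<close>, which is what \<open>even_N\<close> provides below.\<close>

definition quad :: "'a \<Rightarrow> int" where
  "quad x = (if x = 0 then 0 else if even (ind x) then 1 else - 1)"

lemma quad_0 [simp]: "quad 0 = 0"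
  by (simp add: quad_def)

lemma quad_eq_0_iff [simp]: "quad x = 0 \<longleftrightarrow> x = 0"
  by (simp add: quad_def)

lemma quad_cases: "x \<noteq> 0 \<Longrightarrow> quad x = 1 \<or> quad x = - 1"
  by (simp add: quad_def)

lemma quad_square: "x \<noteq> 0 \<Longrightarrow> quad x * quad x = 1"
  by (simp add: quad_def)

end

locale finite_field_generator_odd = finite_field_generator +
  assumes even_N: "2 dvd N"
begin

lemma even_ind_cong: "[ind x = i] (mod int N) \<Longrightarrow> even (ind x) \<longleftrightarrow> even i"
  using cong_N[OF even_N, of "ind x" i] by (auto simp: cong_def even_iff_mod_2_eq_zero)

lemma quad_mult: "quad (x * y) = quad x * quad y"
  using even_ind_cong[OF ind_mult, of x y] by (auto simp: quad_def)

lemma quad_1 [simp]: "quad 1 = 1"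
  using even_ind_cong[OF ind_gen_power[of 0]] by (simp add: quad_def)

lemma quad_gen: "quad \<omega> = - 1"
  using even_ind_cong[OF ind_gen_power[of 1]] gen_nonzero by (simp add: quad_def)

lemma quad_inverse: "quad (inverse x) = quad x"
proof (cases "x = 0")
  case False
  then have "quad x * quad (inverse x) = quad x * quad x"
    using quad_mult[of x "inverse x"] by (simp add: quad_square)
  with False show ?thesis by simp
qed simp

lemma quad_divide: "quad (x / y) = quad x * quad y"
  by (simp add: divide_inverse quad_mult quad_inverse)

lemma quad_power: "quad (x ^ k) = quad x ^ k"
  by (induction k) (simp_all add: quad_mult)

lemma in_C2_iff_quad: "x \<in> C 2 0 \<longleftrightarrow> quad x = 1"
  by (auto simp: C_def quad_def cong_0_iff)

text \<open>Euler's criterion, from \<omega> having \<open>N div 2\<close>-th power -1: that power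
  squares to 1 but is not 1.\<close>

lemma of_int_quad: "of_int (quad x) = x ^ (N div 2)"
proof (cases "x = 0")
  case True
  have "N div 2 > 0" using even_N N_pos by (auto elim: dvdE)
  with True show ?thesis by simp
next
  case False
  have eq: "\<omega> ^ (N div 2) = - 1"
  proof -
    have "(\<omega> ^ (N div 2))\<^sup>2 = 1"
      using power_N[OF gen_nonzero] even_N by (simp flip: power_mult)
    moreover have "\<omega> ^ (N div 2) \<noteq> \<omega> ^ 0"
      unfolding gen_power_eq_iff using N_pos even_N
      by (auto simp: cong_def elim!: dvdE)
    ultimately show ?thesis by (simp add: power2_eq_1_iff)
  qed
  have "x ^ (N div 2) = (\<omega> ^ (N div 2)) ^ nat (ind x)"
    by (metis False gen_power_ind power_mult mult.commute)
  also have "\<dots> = of_int (quad x)"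
    using False ind_nonneg[of x] unfolding eq
    by (auto simp: quad_def minus_one_power_iff even_nat_iff)
  finally show ?thesis by simp
qed

text \<open>Multiplication by the nonsquare \<omega> permutes the field and negates the sum.\<close>

lemma sum_quad: "(\<Sum>x\<in>UNIV. quad x) = 0"
proof -
  have "(\<Sum>x\<in>UNIV. quad x) = (\<Sum>x\<in>UNIV. quad (\<omega> * x))"
    by (rule sum.reindex_bij_witness[where i = "\<lambda>y. \<omega> * y" and j = "\<lambda>y. y / \<omega>"])
       (use gen_nonzero in auto)
  also have "\<dots> = - (\<Sum>x\<in>UNIV. quad x)"
    by (simp add: quad_mult quad_gen sum_negf)
  finally show ?thesis by simp
qed

lemma card_sqrt: "int (card {y. y\<^sup>2 = x}) = 1 + quad x"
proof (cases "quad x = 1")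
  case True
  then show ?thesis using card_roots[OF even_N, of x] by (simp add: in_C2_iff_quad)
next
  case False
  show ?thesis
  proof (cases "x = 0")
    case False
    have "y\<^sup>2 \<noteq> x" for y
      using \<open>quad x \<noteq> 1\<close> False quad_square[of y] by (auto simp: power2_eq_square quad_mult)
    then show ?thesis using quad_cases[OF False] \<open>quad x \<noteq> 1\<close> by simp
  qed simp
qed

text \<open>The product may be replaced by the quotient \<open>(x - a) / (y - a)\<close>, a Moebius
  function of \<open>a\<close> that takes every value except 1 once; the full sum of
  \<open>quad\<close> is 0 and \<open>quad 1 = 1\<close>.\<close>

lemma sum_quad_shifted:
  assumes "x \<noteq> y"
  shows "(\<Sum>a\<in>UNIV. quad ((x - a) * (y - a))) = - 1"
proof -
  have "(\<Sum>a\<in>UNIV. quad ((x - a) * (y - a))) = (\<Sum>a\<in>UNIV - {y}. quad ((x - a) / (y - a)))"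
    by (subst sum.remove[of UNIV y]) (simp_all add: quad_mult quad_divide)
  also have "\<dots> = (\<Sum>w\<in>UNIV - {1}. quad w)"
  proof (rule sum.reindex_bij_witness[where i = "\<lambda>w. y - (x - y) / (w - 1)" and
          j = "\<lambda>a. (x - a) / (y - a)"])
    fix w :: 'a assume "w \<in> UNIV - {1}"
    then have "x - (y - (x - y) / (w - 1)) = w * ((x - y) / (w - 1))"
      by (simp add: field_simps)
    with \<open>w \<in> UNIV - {1}\<close> assms
    show "(x - (y - (x - y) / (w - 1))) / (y - (y - (x - y) / (w - 1))) = w" by simp
  qed (use assms in \<open>auto simp: field_simps\<close>)
  also have "\<dots> = - 1"
    using sum.remove[of UNIV "1::'a" quad] sum_quad by simp
  finally show ?thesis .
qed

end

locale finite_field_generator_12 = finite_field_generator +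
  assumes twelve_dvd_N: "12 dvd N"

sublocale finite_field_generator_12 \<subseteq> finite_field_generator_odd
  by unfold_locales (use twelve_dvd_N in \<open>auto elim: dvd_trans[rotated]\<close>)

context finite_field_generator_12
begin

lemma three_dvd_N: "3 dvd N" and six_dvd_N: "6 dvd N"
  using twelve_dvd_N by (auto elim: dvd_trans[rotated])

lemmas C3_closed = C_mult[OF three_dvd_N] C_inverse[OF three_dvd_N] C_divide[OF three_dvd_N]

text \<open>-1 is \<omega> to the power \<open>N / 2\<close>, and 6 divides \<open>N / 2\<close>.
  Hence signs never matter for the classes of order 2, 3 and 6.\<close>

lemma minus_one_in_C: "- 1 \<in> C 6 0"
proof -
  obtain m where m: "N = 12 * m" using twelve_dvd_N by (elim dvdE)
  have "(\<omega> ^ (6 * m))\<^sup>2 = 1"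
    using power_N[OF gen_nonzero] m by (simp flip: power_mult add: mult.commute)
  moreover have "\<omega> ^ (6 * m) \<noteq> \<omega> ^ 0"
    unfolding gen_power_eq_iff using N_pos m by (auto simp: cong_def)
  ultimately have "- 1 = \<omega> ^ (6 * m)" by (simp add: power2_eq_1_iff)
  moreover have "\<omega> ^ (6 * m) \<in> C 6 0"
    using gen_power_in_C[OF six_dvd_N, of "6 * m"] C_cong[of "int (6 * m)" 0 6]
    by (simp add: cong_0_iff)
  ultimately show ?thesis by simp
qed

lemma C_dvd: "x \<in> C 6 i \<Longrightarrow> d dvd 6 \<Longrightarrow> x \<in> C d i"
  unfolding C_def using cong_dvd_modulus[of "ind x" i 6 "int d"] int_dvd_int_iff[of d 6] by auto

lemma quad_minus_one: "quad (- 1) = 1"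
  using minus_one_in_C[THEN C_dvd, of 2] by (simp add: in_C2_iff_quad)

lemma quad_uminus: "quad (- x) = quad x"
  using quad_mult[of "- 1" x] quad_minus_one by simp

lemma uminus_in_C3: "- x \<in> C 3 i \<longleftrightarrow> x \<in> C 3 i"
  using mult_in_C_iff[OF three_dvd_N minus_one_in_C[THEN C_dvd], of x i] by simp

lemma diff_in_C3: "x - y \<in> C 3 i \<longleftrightarrow> y - x \<in> C 3 i"
  using uminus_in_C3[of "x - y" i] by simp

lemma sum_C3:
  fixes f :: "'a \<Rightarrow> 'b::comm_monoid_add"
  shows "sum f (C 3 0) + sum f (C 3 1) + sum f (C 3 2) = (\<Sum>x | x \<noteq> 0. f x)"
proof -
  have "{0..<3::int} = {0, 1, 2}" by auto
  then show ?thesis using sum_C[OF three_dvd_N, of f] by (simp add: add.assoc)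
qed

text \<open>
  For a cubic character \<open>\<psi>\<close> the Jacobi sum of \<open>\<psi>\<close> and \<open>quad\<close> is \<open>jac 0 + jac 1 \<zeta> + jac 2 \<zeta>\<^sup>2\<close> with a cube root
  of unity \<open>\<zeta>\<close>; since the coefficients sum to \<open>-1\<close>, its real part is \<open>(1 + 3 jac 0)/2\<close>.
\<close>

definition jac :: "int \<Rightarrow> int" where
  "jac i = (\<Sum>u\<in>C 3 i. quad (1 - u))"

lemma jac_cong: "[i = j] (mod 3) \<Longrightarrow> jac i = jac j"
  using C_cong[of i j 3] by (simp add: jac_def)

lemma sum_jac: "jac 0 + jac 1 + jac 2 = - 1"
proof -
  have "jac 0 + jac 1 + jac 2 = (\<Sum>x\<in>UNIV - {0}. quad (1 - x))"
    unfolding jac_def sum_C3 by (rule sum.cong) auto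
  also have "\<dots> = (\<Sum>x\<in>UNIV. quad (1 - x)) - 1"
    by (subst sum.remove[of UNIV 0]) simp_all
  also have "(\<Sum>x\<in>UNIV. quad (1 - x)) = (\<Sum>x\<in>UNIV. quad x)"
    by (rule sum.reindex_bij_witness[where i = "\<lambda>x. 1 - x" and j = "\<lambda>x. 1 - x"]) auto
  finally show ?thesis by (simp add: sum_quad)
qed

text \<open>Cubing covers \<open>C 3 0\<close> three times, and dividing the cubes by
  \<open>a\<close> moves them to the class \<open>- i\<close>, where the sum is
  \<open>jac (- i)\<close>.\<close>

lemma cubic_sum_quad:
  assumes "a \<in> C 3 i"
  shows "(\<Sum>x\<in>UNIV. quad (x ^ 3 - a)) = quad a * (1 + 3 * jac (- i))"
proof -
  have a: "a \<noteq> 0" using assms by (rule C_nonzero)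
  have "(\<Sum>u\<in>C 3 0. quad (u - a)) = (\<Sum>u\<in>C 3 (- i). quad (a * u - a))"
    by (rule sum.reindex_bij_betw[symmetric]) (use bij_betw_C[OF three_dvd_N assms, of "- i"] in simp)
  also have "\<dots> = (\<Sum>u\<in>C 3 (- i). quad a * quad (1 - u))"
  proof (rule sum.cong)
    fix u
    have "a * u - a = - (a * (1 - u))" by (simp add: algebra_simps)
    then show "quad (a * u - a) = quad a * quad (1 - u)" by (simp only: quad_uminus quad_mult)
  qed simp
  finally have "(\<Sum>u\<in>C 3 0. quad (u - a)) = quad a * jac (- i)"
    by (simp add: jac_def sum_distrib_left)
  then show ?thesis
    using sum_power[OF three_dvd_N, of "\<lambda>x. quad (x - a)"] by (simp add: quad_uminus algebra_simps)
qed

text \<open>Both sides evaluate \<open>\<Sum>\<^sub>a (\<Sum>\<^sub>x quad (x\<^sup>3 - a))\<^sup>2\<close>, up to the factor \<open>(CARD('a) - 1)/3\<close>.\<close>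

lemma sum_squares_jac:
  "(1 + 3 * jac 0)\<^sup>2 + (1 + 3 * jac 1)\<^sup>2 + (1 + 3 * jac 2)\<^sup>2 = 6 * int CARD('a)"
proof -
  let ?F = "\<lambda>a. \<Sum>x\<in>UNIV. quad (x ^ 3 - a)"
  let ?E = "{(x, y). x ^ 3 = (y::'a) ^ 3}"
  define q where "q = int CARD('a)"
  have N: "int N = q - 1" using card_eq_Suc_N by (simp add: q_def)
  \<comment> \<open>One pair comes from \<open>x = 0\<close>; each of the \<open>q - 1\<close>
    nonzero \<open>x\<close> has three partners \<open>y\<close> with the same cube.\<close>
  have card_E: "int (card ?E) = 3 * q - 2"
  proof -
    have "?E = (SIGMA x:UNIV. {y. y ^ 3 = x ^ 3})" by auto
    then have "int (card ?E) = (\<Sum>x\<in>UNIV. int (card {y::'a. y ^ 3 = x ^ 3}))"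
      by simp
    also have "\<dots> = int (card {y::'a. y ^ 3 = 0}) + 3 * (\<Sum>x\<in>C 3 0. int (card {y. y ^ 3 = x}))"
      using sum_power[OF three_dvd_N, of "\<lambda>x. int (card {y. y ^ 3 = x})"] by simp
    also have "\<dots> = 1 + 9 * int (card (C 3 0))"
      by (simp add: card_roots[OF three_dvd_N])
    also have "\<dots> = 3 * q - 2"
      using card_C[OF three_dvd_N, of 0] N by simp
    finally show ?thesis .
  qed
  have "(\<Sum>a\<in>UNIV. ?F a ^ 2) =
      (\<Sum>a\<in>UNIV. \<Sum>(x, y)\<in>UNIV. quad ((x ^ 3 - a) * (y ^ 3 - a)))"
    by (simp add: power2_eq_square sum_product sum.cartesian_product quad_mult)
  also have "\<dots> = (\<Sum>(x, y)\<in>UNIV. \<Sum>a\<in>UNIV. quad ((x ^ 3 - a) * (y ^ 3 - a)))"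
    by (subst sum.swap) (simp add: case_prod_unfold)
  \<comment> \<open>For equal cubes the summand is the square of a character value, which is 1
    except at a single \<open>a\<close>; otherwise \<open>sum_quad_shifted\<close> applies.\<close>
  also have "\<dots> = (\<Sum>z\<in>UNIV. if z \<in> ?E then q - 1 else - 1)"
  proof (rule sum.cong)
    fix z :: "'a \<times> 'a"
    have *: "(\<Sum>a\<in>UNIV. quad ((c - a) * (c - a))) = q - 1" for c
    proof -
      have "(\<Sum>a\<in>UNIV. quad ((c - a) * (c - a))) = (\<Sum>a\<in>UNIV - {c}. 1)"
        by (subst sum.remove[of UNIV c]) (auto intro!: sum.cong simp: quad_mult quad_square)
      then show ?thesis by (simp add: card_Diff_singleton q_def card_eq_Suc_N)
    qed
    show "(case z of (x, y) \<Rightarrow> \<Sum>a\<in>UNIV. quad ((x ^ 3 - a) * (y ^ 3 - a))) =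
        (if z \<in> ?E then q - 1 else - 1)"
      using * sum_quad_shifted by (auto split: prod.splits)
  qed simp
  also have "\<dots> = (\<Sum>z\<in>UNIV. (if z \<in> ?E then q else 0) - 1)"
    by (rule sum.cong) auto
  also have "\<dots> = q * int (card ?E) - q * q"
    unfolding sum_subtractf
    by (simp add: q_def sum.If_cases)
  finally have total: "(\<Sum>a\<in>UNIV. ?F a ^ 2) = 2 * q * (q - 1)"
    unfolding card_E by (simp add: algebra_simps)
  have class_sum: "3 * (\<Sum>a\<in>C 3 i. ?F a ^ 2) = (q - 1) * (1 + 3 * jac (- i)) ^ 2" for i
  proof -
    have "(\<Sum>a\<in>C 3 i. ?F a ^ 2) = (\<Sum>a\<in>C 3 i. (1 + 3 * jac (- i)) ^ 2)"
    proof (rule sum.cong)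
      fix a assume "a \<in> C 3 i"
      then show "?F a ^ 2 = (1 + 3 * jac (- i)) ^ 2"
        using quad_square[of a] C_nonzero[of a 3 i]
        by (simp add: cubic_sum_quad power_mult_distrib power2_eq_square[of "quad a"])
    qed simp
    then show ?thesis using card_C[OF three_dvd_N, of i] N by simp
  qed
  have "(\<Sum>a\<in>UNIV. ?F a ^ 2) = ?F 0 ^ 2 + (\<Sum>a\<in>UNIV - {0}. ?F a ^ 2)"
    by (rule sum.remove) simp_all
  \<comment> \<open>On cubes \<open>quad (x ^ 3) = quad x\<close>, so this is the full character
    sum.\<close>
  also have "?F 0 = 0"
  proof -
    have "quad (x ^ 3) = quad x" for x
      using quad_cases[of x] by (cases "x = 0") (auto simp: quad_power)
    then show ?thesis by (simp add: sum_quad)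
  qed
  also have "(\<Sum>a\<in>UNIV - {0}. ?F a ^ 2) = (\<Sum>a | a \<noteq> 0. ?F a ^ 2)"
    by (rule sum.cong) auto
  also have "\<dots> = (\<Sum>a\<in>C 3 0. ?F a ^ 2) + (\<Sum>a\<in>C 3 1. ?F a ^ 2) + (\<Sum>a\<in>C 3 2. ?F a ^ 2)"
    by (rule sum_C3[symmetric])
  finally have "3 * (\<Sum>a\<in>UNIV. ?F a ^ 2) =
      (q - 1) * ((1 + 3 * jac 0)\<^sup>2 + (1 + 3 * jac (- 1))\<^sup>2 + (1 + 3 * jac (- 2))\<^sup>2)"
    using class_sum[of 0] class_sum[of 1] class_sum[of 2] by (simp add: algebra_simps)
  moreover have "jac (- 1) = jac 2" "jac (- 2) = jac 1" by (auto intro!: jac_cong simp: cong_def)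
  ultimately have "(q - 1) * (6 * q) = (q - 1) * ((1 + 3 * jac 0)\<^sup>2 + (1 + 3 * jac 1)\<^sup>2 + (1 + 3 * jac 2)\<^sup>2)"
    unfolding total by (simp add: algebra_simps)
  moreover have "q - 1 \<noteq> 0" using N N_pos by simp
  ultimately show ?thesis unfolding q_def by (metis mult_cancel_left)
qed

text \<open>Each cubic class has even size because \<open>12 dvd N\<close>, and every summand of
  \<open>jac\<close> is 1 or -1, except the zero summand at \<open>u = 1\<close>, which occurs in
  \<open>jac 0\<close> only.\<close>

lemma odd_jac_0: "odd (jac 0)" and even_jac_diff: "even (jac 1 - jac 2)"
proof -
  have "4 dvd 3 * card (C 3 i)" for i
    unfolding card_C[OF three_dvd_N] using twelve_dvd_N by (auto elim: dvd_trans[rotated])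
  then have even_card: "even (card (C 3 i))" for i
    using coprime_dvd_mult_right_iff[of 4 3 "card (C 3 i)"]
    by (meson coprime_Suc_left_nat dvd_trans even_numeral even_mult_iff odd_numeral)
  have parity: "even (sum f A) \<longleftrightarrow> even (card A)"
    if "finite A" "\<And>x. x \<in> A \<Longrightarrow> odd (f x)" for f :: "'a \<Rightarrow> int" and A
    using that by (induction A rule: finite_induct) auto
  have odd_quad: "odd (quad x)" if "x \<noteq> 0" for x
    using quad_cases[OF that] by auto
  have one: "1 \<in> C 3 0" by (rule one_in_C[OF three_dvd_N])
  have "jac 0 = (\<Sum>u\<in>C 3 0 - {1}. quad (1 - u))"
    unfolding jac_def by (subst sum.remove[OF _ one]) simp_all
  moreover have "odd (card (C 3 0 - {1}))"
    using even_card[of 0] one card_gt_0_iff[of "C 3 0"] by (auto simp: card_Diff_singleton)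
  ultimately show "odd (jac 0)"
    using parity[of "C 3 0 - {1}" "\<lambda>u. quad (1 - u)"] odd_quad by auto
  have "even (jac i)" if "1 \<notin> C 3 i" for i
  proof -
    have "odd (quad (1 - u))" if "u \<in> C 3 i" for u
      using \<open>1 \<notin> C 3 i\<close> that by (intro odd_quad) auto
    with parity[of "C 3 i" "\<lambda>u. quad (1 - u)"] even_card[of i] show ?thesis
      by (simp add: jac_def)
  qed
  moreover have "1 \<notin> C 3 1" "1 \<notin> C 3 2"
    using C_unique[OF one, of 1] C_unique[OF one, of 2] by (auto simp: cong_def)
  ultimately show "even (jac 1 - jac 2)" by simp
qed

text \<open>The Jacobi sum is A + B sqrt(-3) with \<open>2 * B = jac 1 - jac 2\<close>. Eliminating
  \<open>jac 1\<close> and \<open>jac 2\<close> by \<open>sum_jac\<close> turns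
  \<open>sum_squares_jac\<close> into the statement that its norm is the field size.\<close>

lemma jac_norm:
  obtains A B where "1 + 3 * jac 0 = 2 * A" "A\<^sup>2 + 3 * B\<^sup>2 = int CARD('a)"
proof -
  from odd_jac_0 have "even (1 + 3 * jac 0)" by simp
  then obtain A where A: "1 + 3 * jac 0 = 2 * A" by blast
  from even_jac_diff obtain B where B: "jac 1 - jac 2 = 2 * B" by blast
  have "jac 1 + jac 2 = - 1 - jac 0" using sum_jac by simp
  then have "6 * jac 1 = - 3 - 3 * jac 0 + 6 * B" "6 * jac 2 = - 3 - 3 * jac 0 - 6 * B"
    using B by linarith+
  then have "1 + 3 * jac 1 = - A + 3 * B" "1 + 3 * jac 2 = - A - 3 * B"
    using A by linarith+
  from sum_squares_jac[unfolded A this] have "6 * (A\<^sup>2 + 3 * B\<^sup>2) = 6 * int CARD('a)"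
    by (simp add: power2_eq_square algebra_simps)
  then have "A\<^sup>2 + 3 * B\<^sup>2 = int CARD('a)" by simp
  with A show ?thesis by (rule that)
qed

end

section \<open>The real part of the Jacobi sum\<close>

text \<open>With q for the prime power, q divides \<open>(A * b - B) * (A * b + B)\<close>, and
  \<open>p\<close> cannot divide both factors without dividing \<open>2 * A * b\<close>. So q
  divides one factor, and a size estimate makes that factor 0, which forces
  \<open>A\<^sup>2 = 1\<close>.\<close>

lemma prime_power_norm_form_unique:
  fixes A B b :: int and p n :: nat
  assumes "prime p" and "int (p ^ n) = 1 + 3 * b\<^sup>2" and "A\<^sup>2 + 3 * B\<^sup>2 = int (p ^ n)"
    and "\<not> int p dvd A" and "odd p"
  shows "A = 1 \<or> A = - 1"
proof (cases "n = 0")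
  case True
  with assms have "b\<^sup>2 = 0" "A\<^sup>2 + 3 * B\<^sup>2 = 1" by auto
  moreover have "B\<^sup>2 \<ge> 0" "A\<^sup>2 \<ge> 0" by simp_all
  ultimately have "B\<^sup>2 = 0" by linarith
  with \<open>A\<^sup>2 + 3 * B\<^sup>2 = 1\<close> show ?thesis by (simp add: power2_eq_1_iff)
next
  case False
  define q where "q = int (p ^ n)"
  have q: "q = 1 + 3 * b\<^sup>2" "A\<^sup>2 + 3 * B\<^sup>2 = q"
    using assms by (simp_all add: q_def)
  have "q > 0" using prime_gt_0_nat[of p] assms(1) by (simp add: q_def)
  have pq: "int p dvd q" using False by (auto simp: q_def dvd_power)
  have p: "prime (int p)" using assms by simp
  have "\<not> int p dvd b"
  proof
    assume "int p dvd b"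
    then have "int p dvd q - 3 * b\<^sup>2" using pq by (simp add: power2_eq_square)
    with q(1) p show False by (auto simp: zdvd1_eq)
  qed
  moreover have "\<not> int p dvd 2"
  proof
    assume "int p dvd 2"
    then have "p dvd 2" by (metis int_dvd_int_iff of_nat_numeral)
    then have "p = 2" using assms(1) primes_dvd_imp_eq two_is_prime_nat by blast
    with \<open>odd p\<close> show False by simp
  qed
  ultimately have ndvd: "\<not> int p dvd 2 * A * b"
    using assms(4) p by (simp add: prime_dvd_mult_iff)
  \<comment> \<open>Here \<open>c\<close> stands for \<open>b\<close> or \<open>- b\<close>, so that
    both factors are treated at once.\<close>
  have conclude: "A = 1 \<or> A = - 1" if dvd: "q dvd A * c - B" and c: "c\<^sup>2 = b\<^sup>2" for c
  proof -
    obtain k where k: "A * c - B = q * k" using dvd by (elim dvdE)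
    have "q\<^sup>2 = (1 + 3 * c\<^sup>2) * (A\<^sup>2 + 3 * B\<^sup>2)"
      using q(1,2) c by (simp add: power2_eq_square)
    \<comment> \<open>Multiplicativity of the norm form. If \<open>k\<close> were nonzero, the last
      term would be at least three times the left side.\<close>
    also have "\<dots> = (A + 3 * B * c)\<^sup>2 + 3 * (A * c - B)\<^sup>2"
      by (simp add: power2_eq_square algebra_simps)
    finally have eq: "q\<^sup>2 = (A + 3 * B * c)\<^sup>2 + 3 * (q\<^sup>2 * k\<^sup>2)"
      unfolding k by (simp add: power_mult_distrib)
    have "k = 0"
    proof (rule ccontr)
      assume "k \<noteq> 0"
      then have "1 \<le> k\<^sup>2" by (simp add: int_one_le_iff_zero_less)
      then have "q\<^sup>2 * 1 \<le> q\<^sup>2 * k\<^sup>2" by (intro mult_left_mono) simp_all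
      with eq have "q\<^sup>2 \<ge> 3 * q\<^sup>2" by (smt (verit) zero_le_power2)
      with \<open>q > 0\<close> show False by simp
    qed
    with k have "B = A * c" by simp
    with q c have "A\<^sup>2 * q = 1 * q" by (simp add: power_mult_distrib algebra_simps)
    with \<open>q > 0\<close> show ?thesis by (simp add: power2_eq_1_iff)
  qed
  have "(A * b - B) * (A * b + B) = q * (b\<^sup>2 - B\<^sup>2)"
  proof -
    have A2: "A\<^sup>2 = q - 3 * B\<^sup>2" using q(2) by simp
    have "(A * b - B) * (A * b + B) = A\<^sup>2 * b\<^sup>2 - B\<^sup>2"
      by (simp add: power2_eq_square algebra_simps)
    also have "\<dots> = (q - 3 * B\<^sup>2) * b\<^sup>2 - B\<^sup>2" unfolding A2 ..
    also have "\<dots> = q * b\<^sup>2 - B\<^sup>2 * (1 + 3 * b\<^sup>2)" by (simp add: algebra_simps)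
    also have "\<dots> = q * (b\<^sup>2 - B\<^sup>2)" unfolding q(1)[symmetric] by (simp add: algebra_simps)
    finally show ?thesis .
  qed
  then have dvd: "int p ^ n dvd (A * b - B) * (A * b + B)" by (simp add: q_def)
  show ?thesis
  proof (cases "int p dvd A * b - B")
    case False
    then have "coprime (int p ^ n) (A * b - B)"
      using p by (simp add: prime_imp_coprime)
    with dvd have "q dvd A * b + B"
      unfolding q_def by (simp add: coprime_dvd_mult_right_iff)
    then have "q dvd A * (- b) - B"
      using dvd_minus_iff[of q "A * b + B"] by simp
    then show ?thesis by (rule conclude) simp
  next
    case True
    have "\<not> int p dvd A * b + B"
    proof
      assume "int p dvd A * b + B"
      with True have "int p dvd (A * b - B) + (A * b + B)" by (rule dvd_add)
      with ndvd show False by (simp add: mult.assoc)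
    qed
    then have "coprime (int p ^ n) (A * b + B)"
      using p by (simp add: prime_imp_coprime)
    with dvd have "q dvd A * b - B"
      unfolding q_def by (simp add: coprime_dvd_mult_left_iff)
    then show ?thesis by (rule conclude) simp
  qed
qed

text \<open>The multiples of \<open>p\<close> among the factors of the factorial contribute
  \<open>p ^ m * fact m\<close>; \<open>u\<close> is the product of the other factors.\<close>

lemma fact_prime_times_add:
  fixes p m a :: nat
  assumes p: "prime p" and "a < p"
  shows "\<exists>u. fact (p * m + a) = p ^ m * fact m * u \<and> \<not> p dvd u"
proof -
  have add: "\<exists>u. fact (p * m + a) = fact (p * m) * u \<and> \<not> p dvd u" if "a < p" for a m
    using that
  proof (induction a)
    case 0
    show ?case using p by (intro exI[of _ 1]) (auto simp: prime_nat_iff)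
  next
    case (Suc a)
    then obtain u where u: "fact (p * m + a) = fact (p * m) * u" "\<not> p dvd u" by auto
    have "\<not> p dvd Suc (p * m + a)"
    proof
      assume "p dvd Suc (p * m + a)"
      then have "p dvd p * m + Suc a" by simp
      then have "p dvd Suc a" using dvd_add_right_iff[of p "p * m" "Suc a"] by simp
      with Suc.prems show False by (auto dest: dvd_imp_le)
    qed
    with u(2) have "\<not> p dvd u * Suc (p * m + a)"
      using prime_dvd_mult_iff[OF p] by blast
    moreover have "fact (p * m + Suc a) = fact (p * m) * (u * Suc (p * m + a))"
      using u(1) by (simp add: algebra_simps)
    ultimately show ?case by blast
  qed
  have "\<exists>u. fact (p * m) = p ^ m * fact m * u \<and> \<not> p dvd u"
  proof (induction m)
    case 0
    show ?case using p by (intro exI[of _ 1]) (auto simp: prime_nat_iff)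
  next
    case (Suc m)
    then obtain u where u: "fact (p * m) = p ^ m * fact m * u" "\<not> p dvd u" by auto
    \<comment> \<open>From \<open>p * m\<close> to \<open>p * Suc m\<close> there are
      \<open>p - 1\<close> factors prime to \<open>p\<close>, followed by the factor
      \<open>p * Suc m\<close> itself.\<close>
    have p1: "p - 1 < p" using prime_gt_0_nat[OF p] by simp
    from add[OF this, of m] obtain w where
      w: "fact (p * m + (p - 1)) = fact (p * m) * w" "\<not> p dvd w" by auto
    have eq: "p * Suc m = Suc (p * m + (p - 1))" using p1 by simp
    have "fact (p * Suc m) = p * Suc m * fact (p * m + (p - 1))"
      unfolding eq fact_Suc of_nat_id by (simp only: flip: eq)
    then show ?case using w u p
      by (intro exI[of _ "u * w"]) (simp add: prime_dvd_mult_iff algebra_simps)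
  qed
  then obtain u where u: "fact (p * m) = p ^ m * fact m * u" "\<not> p dvd u" by auto
  from add[OF assms(2), of m] obtain w where
    w: "fact (p * m + a) = fact (p * m) * w" "\<not> p dvd w" by auto
  with u p show ?thesis
    by (intro exI[of _ "u * w"]) (simp add: prime_dvd_mult_iff algebra_simps)
qed

text \<open>One digit of Lucas' theorem: since \<open>c \<le> a\<close>, the lowest
  base-\<open>p\<close> digits subtract without a borrow, so all three factorials split by
  \<open>fact_prime_times_add\<close> and the powers of \<open>p\<close> cancel.\<close>

lemma prime_dvd_binomial_digit_iff:
  fixes p m l a c :: nat
  assumes p: "prime p" and "a < p" "c \<le> a" "l \<le> m"
  shows "p dvd ((p * m + a) choose (p * l + c)) \<longleftrightarrow> p dvd (m choose l)"
proof -
  obtain u where u: "fact (p * m + a) = p ^ m * fact m * u" "\<not> p dvd u"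
    using fact_prime_times_add[OF p, of a m] assms by auto
  obtain w where w: "fact (p * l + c) = p ^ l * fact l * w" "\<not> p dvd w"
    using fact_prime_times_add[OF p, of c l] assms by auto
  have "a - c < p" using assms by simp
  then obtain z where z: "fact (p * (m - l) + (a - c)) = p ^ (m - l) * fact (m - l) * z" "\<not> p dvd z"
    using fact_prime_times_add[OF p \<open>a - c < p\<close>, of "m - l"] by blast
  have le: "p * l + c \<le> p * m + a" using assms by (intro add_mono mult_left_mono) auto
  have diff: "p * m + a - (p * l + c) = p * (m - l) + (a - c)"
    using assms by (simp add: diff_mult_distrib2)
  let ?C = "(p * m + a) choose (p * l + c)"
  have "fact (p * l + c) * fact (p * (m - l) + (a - c)) * ?C = fact (p * m + a)"
    using binomial_fact_lemma[OF le] unfolding diff by simp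
  also have "\<dots> = p ^ (l + (m - l)) * (fact l * fact (m - l) * (m choose l)) * u"
    using binomial_fact_lemma[OF assms(4)] u assms(4) by simp
  finally have "(p ^ l * p ^ (m - l) * fact l * fact (m - l)) * (w * z * ?C) =
      (p ^ l * p ^ (m - l) * fact l * fact (m - l)) * ((m choose l) * u)"
    unfolding w z power_add by (simp only: mult_ac)
  then have "w * z * ?C = (m choose l) * u"
    using prime_gt_0_nat[OF p] by simp
  then have "p dvd w * z * ?C \<longleftrightarrow> p dvd (m choose l) * u" by simp
  with u w z p show ?thesis by (simp add: prime_dvd_mult_iff)
qed

text \<open>With \<open>p = 6 * r + 1\<close>, all base-\<open>p\<close> digits of the upper number
  are \<open>3 * r\<close> and those of the lower one are \<open>2 * r\<close>; the induction strips
  one digit at a time.\<close>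

lemma not_dvd_binomial_half_third:
  assumes p: "prime (6 * r + 1 :: nat)"
  shows "\<not> 6 * r + 1 dvd ((((6 * r + 1) ^ n - 1) div 2) choose (((6 * r + 1) ^ n - 1) div 3))"
proof (induction n)
  case 0
  show ?case using p by (auto simp: prime_nat_iff)
next
  case (Suc n)
  let ?p = "6 * r + 1"
  have "[?p ^ n = 1 ^ n] (mod 6)" by (intro cong_pow) (simp add: cong_def)
  then obtain k where k: "?p ^ n = 6 * k + 1"
    using cong_le_nat[of 1 "?p ^ n" 6] by (auto simp: cong_sym_eq mult.commute)
  have Suc_eq: "?p ^ Suc n - 1 = 6 * (?p * k + r)" unfolding power_Suc k by (simp add: algebra_simps)
  have "6 * (?p * k + r) div 2 = ?p * (3 * k) + 3 * r" "6 * (?p * k + r) div 3 = ?p * (2 * k) + 2 * r"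
    by (simp_all add: algebra_simps)
  moreover have "\<not> ?p dvd (3 * k choose (2 * k))"
    using Suc.IH unfolding k by simp
  then have "\<not> ?p dvd ((?p * (3 * k) + 3 * r) choose (?p * (2 * k) + 2 * r))"
    by (subst prime_dvd_binomial_digit_iff[OF p]) simp_all
  ultimately show ?case by (simp only: Suc_eq not_False_eq_True)
qed

section \<open>Power sums, and the Jacobi sum modulo the characteristic\<close>

context finite_field_generator
begin

lemma of_nat_card: "of_nat CARD('a) = (0::'a)"
  using CHAR_dvd_CARD[where 'a = 'a] by (simp add: of_nat_eq_0_iff_char_dvd)

text \<open>Replacing \<open>x\<close> by \<omega> times \<open>x\<close> multiplies the sum by the
  \<open>k\<close>-th power of \<omega>, so the sum vanishes unless that is 1. If
  \<open>N dvd k\<close>, the nonzero elements contribute \<open>N\<close> ones, that is -1, and 0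
  contributes only for \<open>k = 0\<close>.\<close>

lemma sum_powers: "(\<Sum>x\<in>UNIV. x ^ k) = (if k > 0 \<and> N dvd k then - 1 else (0::'a))"
proof -
  have N: "of_nat N = (- 1 :: 'a)"
    using of_nat_card unfolding card_eq_Suc_N by (simp add: add_eq_0_iff)
  consider "k = 0" | "k > 0" "N dvd k" | "\<not> N dvd k" by auto
  then show ?thesis
  proof cases
    case 1
    then show ?thesis using of_nat_card by simp
  next
    case 2
    have "(\<Sum>x\<in>UNIV. x ^ k) = (\<Sum>x\<in>UNIV - {0}. (x::'a) ^ k)"
      using 2 by (subst sum.remove[of UNIV 0]) (simp_all add: zero_power)
    also have "\<dots> = (\<Sum>x\<in>UNIV - {0::'a}. 1)"
      using 2(2) by (intro sum.cong) (auto elim!: dvdE simp: power_mult power_N)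
    finally show ?thesis using 2 N by (simp add: card_Diff_singleton card_eq_Suc_N)
  next
    case 3
    have "(\<Sum>x\<in>UNIV. x ^ k) = (\<Sum>x\<in>UNIV. (\<omega> * x) ^ k)"
      by (rule sum.reindex_bij_witness[where i = "\<lambda>y. \<omega> * y" and j = "\<lambda>y. y / \<omega>"])
         (use gen_nonzero in auto)
    then have "(1 - \<omega> ^ k) * (\<Sum>x\<in>UNIV. x ^ k) = 0"
      by (simp add: power_mult_distrib left_diff_distrib flip: sum_distrib_left)
    moreover have "\<omega> ^ k \<noteq> \<omega> ^ 0"
      unfolding gen_power_eq_iff using 3 by (simp add: cong_0_iff)
    ultimately show ?thesis using 3 by simp
  qed
qed

end

context finite_field_generator_12
begin

text \<open>Euler's criterion turns the character sum into a sum of values of the polynomial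
  \<open>(x ^ 3 + 1) ^ (N div 2)\<close>, in which only the term of degree \<open>N\<close> survives
  summation.\<close>

lemma of_int_jac_0: "of_int (1 + 3 * jac 0) = - (of_nat ((N div 2) choose (N div 3)) :: 'a)"
proof -
  obtain m where m: "N = 12 * m" using twelve_dvd_N by (elim dvdE)
  with N_pos have "m > 0" by simp
  \<comment> \<open>The choice \<open>a = - 1\<close> in \<open>cubic_sum_quad\<close> is possible
    as -1 is a cube and a square.\<close>
  have "1 + 3 * jac 0 = (\<Sum>x\<in>UNIV. quad (x ^ 3 - (- 1)))"
    using cubic_sum_quad[OF C_dvd[OF minus_one_in_C, of 3]] quad_minus_one by simp
  then have "of_int (1 + 3 * jac 0) = (\<Sum>x\<in>UNIV. of_int (quad (x ^ 3 - (- 1))) :: 'a)"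
    by (simp only: of_int_sum)
  also have "\<dots> = (\<Sum>x\<in>UNIV. (x ^ 3 + 1) ^ (N div 2))"
    by (simp only: of_int_quad diff_minus_eq_add)
  also have "\<dots> = (\<Sum>x\<in>UNIV. \<Sum>j\<le>N div 2. of_nat ((N div 2) choose j) * x ^ (3 * j))"
    by (simp add: binomial_ring power_mult)
  also have "\<dots> = (\<Sum>j\<le>N div 2. of_nat ((N div 2) choose j) * (\<Sum>x\<in>UNIV. (x::'a) ^ (3 * j)))"
    by (subst sum.swap) (simp add: sum_distrib_left)
  also have "\<dots> = (\<Sum>j\<le>N div 2. if j = N div 3 then - of_nat ((N div 2) choose (N div 3)) else 0)"
  proof (rule sum.cong)
    fix j assume j: "j \<in> {..N div 2}"
    \<comment> \<open>Since \<open>3 * j\<close> is at most \<open>3 * N / 2\<close>, its only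
      possible positive value divisible by \<open>N\<close> is \<open>N\<close> itself.\<close>
    have "3 * j > 0 \<and> N dvd 3 * j \<longleftrightarrow> j = N div 3"
    proof
      assume *: "3 * j > 0 \<and> N dvd 3 * j"
      then obtain k where k: "3 * j = N * k" by (auto elim: dvdE)
      then have j4: "j = 4 * m * k" using m by simp
      have "k < 2"
      proof (rule ccontr)
        assume "\<not> k < 2"
        then have "4 * m * 2 \<le> 4 * m * k" by (intro mult_left_mono) auto
        with j j4 m \<open>m > 0\<close> show False by simp
      qed
      with * k have "k = 1" by (cases k) auto
      with j4 m show "j = N div 3" by simp
    qed (use m \<open>m > 0\<close> in auto)
    then show "of_nat ((N div 2) choose j) * (\<Sum>x\<in>UNIV. (x::'a) ^ (3 * j)) =
        (if j = N div 3 then - of_nat ((N div 2) choose (N div 3)) else 0)"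
      by (simp only: sum_powers) simp
  qed simp
  also have "\<dots> = - of_nat ((N div 2) choose (N div 3))"
    using m by simp
  finally show ?thesis .
qed

text \<open>\<open>-3\<close> is a square in the prime field, which therefore contains a primitive cube root of unity.\<close>

lemma CHAR_mod_3:
  fixes b :: int
  assumes b: "int CARD('a) = 1 + 3 * b\<^sup>2" and p: "prime p" and CHAR: "CHAR('a) = p" and "odd p"
  shows "p mod 3 = 1"
proof -
  \<comment> \<open>Images of integers lie in the prime field, which Frobenius fixes.\<close>
  have fermat: "(of_int c :: 'a) ^ p = of_int c" for c
  proof -
    have "(of_nat k :: 'a) ^ p = of_nat k" for k
      using p CHAR prime_gt_0_nat[OF p] by (induction k) (simp_all add: freshmans_dream zero_power)
    from this[of "nat (c mod int p)"] have "(of_int (c mod int p) :: 'a) ^ p = of_int (c mod int p)"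
      using prime_gt_0_nat[OF p] by simp
    moreover have "(of_int (c mod int p) :: 'a) = of_int c"
      unfolding of_int_eq_iff_cong_CHAR CHAR by (simp add: cong_def)
    ultimately show ?thesis by simp
  qed
  define B where "B = (of_int b :: 'a)"
  have "(of_int (1 + 3 * b\<^sup>2) :: 'a) = 0"
    using of_nat_card by (simp flip: b)
  then have B: "1 + 3 * B\<^sup>2 = 0" by (simp add: B_def)
  then have "B \<noteq> 0" by auto
  have two: "(2::'a) \<noteq> 0"
  proof
    assume "(2::'a) = 0"
    then have "p dvd 2" using of_nat_eq_0_iff_char_dvd[of 2, where 'a = 'a] CHAR by simp
    with p \<open>odd p\<close> show False
      using primes_dvd_imp_eq two_is_prime_nat by blast
  qed
  \<comment> \<open>This is (-1 + s) / 2 with s = 1 / B, a square root of -3.\<close>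
  define z where "z = (1 - B) / (2 * B)"
  have zp: "z ^ p = z"
    using fermat[of "1 - b"] fermat[of "2 * b"] by (simp add: z_def B_def power_divide)
  have zB: "2 * B * z = 1 - B"
    using two \<open>B \<noteq> 0\<close> by (simp add: z_def)
  have "(2 * B)\<^sup>2 * (z\<^sup>2 + z + 1) = (2 * B * z)\<^sup>2 + 2 * B * (2 * B * z) + (2 * B)\<^sup>2"
    by (simp add: power2_eq_square algebra_simps)
  also have "\<dots> = 1 + 3 * B\<^sup>2"
    unfolding zB by (simp add: power2_eq_square algebra_simps)
  finally have "(2 * B)\<^sup>2 * (z\<^sup>2 + z + 1) = 0" using B by simp
  moreover have "(2 * B)\<^sup>2 \<noteq> 0" using two \<open>B \<noteq> 0\<close> by (metis mult_eq_0_iff power_not_zero)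
  ultimately have z2: "z\<^sup>2 + z + 1 = 0" by (metis mult_eq_0_iff)
  have z1: "z \<noteq> 1"
  proof
    assume "z = 1"
    with z2 have "(3::'a) = 0" by simp
    with B show False by simp
  qed
  have "z ^ 3 - 1 = (z - 1) * (z\<^sup>2 + z + 1)" by (simp add: power2_eq_square power3_eq_cube algebra_simps)
  with z2 have z3: "z ^ 3 = 1" by simp
  then have "z \<noteq> 0" by auto
  \<comment> \<open>Frobenius fixes \<open>z\<close>, so \<open>z ^ (p mod 3) = z\<close>; residue 0
    or 2 would give \<open>z = 1\<close>.\<close>
  have "z ^ p = z ^ (3 * (p div 3) + p mod 3)" by simp
  also have "\<dots> = z ^ (p mod 3)" unfolding power_add power_mult z3 by simp
  finally have "z ^ (p mod 3) = z" using zp by simp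
  moreover have "p mod 3 = 0 \<or> p mod 3 = 1 \<or> p mod 3 = 2" by presburger
  ultimately show ?thesis
    using z1 \<open>z \<noteq> 0\<close> by (auto simp: power2_eq_square)
qed

text \<open>The binomial coefficient congruent to \<open>- 2 * A\<close> is prime to the
  characteristic, hence so is \<open>A\<close>, and uniqueness of the norm form gives
  \<open>A = 1\<close> or \<open>A = - 1\<close>.\<close>

lemma jac_0_eq_minus_one:
  fixes b :: int
  assumes b: "int CARD('a) = 1 + 3 * b\<^sup>2" and "primepow CARD('a)" and "even b"
  shows "jac 0 = - 1"
proof -
  obtain p n where p: "prime p" and n: "n > 0" and card: "CARD('a) = p ^ n"
    using assms(2) by (auto simp: primepow_def)
  have "(of_nat p :: 'a) ^ n = 0" using of_nat_card unfolding card by simp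
  then have "CHAR('a) dvd p" by (simp add: of_nat_eq_0_iff_char_dvd)
  then have CHAR: "CHAR('a) = p" using p CHAR_not_1 by (auto simp: prime_nat_iff)
  have "odd CARD('a)"
    using even_N unfolding card_eq_Suc_N by simp
  then have "odd p" using n card by simp
  have "p mod 3 = 1" by (rule CHAR_mod_3[OF b p CHAR \<open>odd p\<close>])
  with \<open>odd p\<close> have "p mod 6 = 1" by presburger
  then obtain r where r: "p = 6 * r + 1" by (metis mult_div_mod_eq)
  obtain A B where AB: "1 + 3 * jac 0 = 2 * A" "A\<^sup>2 + 3 * B\<^sup>2 = int CARD('a)"
    by (rule jac_norm)
  have "\<not> p dvd ((N div 2) choose (N div 3))"
  proof -
    have "N = (6 * r + 1) ^ n - 1" using card card_eq_Suc_N r by simp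
    then show ?thesis using not_dvd_binomial_half_third[OF p[unfolded r], of n] unfolding r by metis
  qed
  then have "(of_int (2 * A) :: 'a) \<noteq> 0"
    unfolding AB(1)[symmetric] of_int_jac_0 by (simp add: of_nat_eq_0_iff_char_dvd CHAR)
  then have "\<not> int p dvd A" by (auto simp: of_int_eq_0_iff_char_dvd CHAR)
  then have "A = 1 \<or> A = - 1"
    using prime_power_norm_form_unique[of p n b A B] p card b AB(2) \<open>odd p\<close> by simp
  \<comment> \<open>\<open>A = 1\<close> would give \<open>3 * jac 0 = 1\<close>.\<close>
  with AB(1) show ?thesis by presburger
qed

end

section \<open>Cyclotomic numbers of order six\<close>

context finite_field_generator_12
begin

text \<open>The sizes of these sets are the cyclotomic numbers of order three, as
  \<open>1 - u\<close> and \<open>u - 1\<close> lie in the same cubic class.\<close>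

definition P :: "int \<Rightarrow> int \<Rightarrow> 'a set" where
  "P i j = {u \<in> C 3 i. 1 - u \<in> C 3 j}"

text \<open>Squares minus nonsquares in \<open>P i j\<close>; together with the size of
  \<open>P i j\<close> this gives the refinement to order six.\<close>

definition \<sigma> :: "int \<Rightarrow> int \<Rightarrow> int" where
  "\<sigma> i j = (\<Sum>u\<in>P i j. quad u)"

lemma P_cong: "[i = i'] (mod 3) \<Longrightarrow> [j = j'] (mod 3) \<Longrightarrow> P i j = P i' j'"
  using C_cong[of i i' 3] C_cong[of j j' 3] by (simp add: P_def)

lemma bij_betw_P_swap: "bij_betw (\<lambda>u. 1 - u) (P i j) (P j i)"
  by (rule bij_betwI[where g = "\<lambda>u. 1 - u"]) (auto simp: P_def)

lemma inverse_in_P: "u \<in> P i j \<Longrightarrow> inverse u \<in> P (- i) (j - i)"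
proof -
  assume "u \<in> P i j"
  then have u: "u \<in> C 3 i" "1 - u \<in> C 3 j" by (auto simp: P_def)
  have "1 - inverse u = - ((1 - u) / u)" using C_nonzero[OF u(1)] by (simp add: field_simps)
  moreover have "(1 - u) / u \<in> C 3 (j - i)" using u C3_closed by blast
  ultimately have "1 - inverse u \<in> C 3 (j - i)" by (simp only: uminus_in_C3)
  with u C3_closed show ?thesis by (auto simp: P_def)
qed

lemma bij_betw_P_inverse: "bij_betw inverse (P i j) (P (- i) (j - i))"
proof (rule bij_betwI[where g = inverse])
  show "inverse \<in> P (- i) (j - i) \<rightarrow> P i j"
    using inverse_in_P[of _ "- i" "j - i"] by auto
qed (auto intro: inverse_in_P)

lemma \<sigma>_inverse: "\<sigma> i j = \<sigma> (- i) (j - i)"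
  unfolding \<sigma>_def
  by (subst sum.reindex_bij_betw[OF bij_betw_P_inverse[of i j], symmetric]) (simp add: quad_inverse)

lemma card_P_swap: "card (P i j) = card (P j i)"
  by (rule bij_betw_same_card[OF bij_betw_P_swap])

lemma card_P_inverse: "card (P i j) = card (P (- i) (j - i))"
  by (rule bij_betw_same_card[OF bij_betw_P_inverse])

lemma in_C3_unique: "x \<in> C 3 i \<Longrightarrow> x \<in> C 3 j \<longleftrightarrow> [i = j] (mod 3)"
  using C_unique[of x 3 i j] C_cong[of i j 3] by auto

lemma sum_C3_filter:
  fixes f :: "'a \<Rightarrow> 'b::comm_monoid_add"
  shows "(\<Sum>u | u \<in> C 3 0 \<and> Q u. f u) + (\<Sum>u | u \<in> C 3 1 \<and> Q u. f u) + (\<Sum>u | u \<in> C 3 2 \<and> Q u. f u)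
    = (\<Sum>u | u \<noteq> 0 \<and> Q u. f u)"
proof -
  have "(\<Sum>u | u \<in> A \<and> Q u. f u) = (\<Sum>u\<in>A. if Q u then f u else 0)" for A :: "'a set"
    by (subst sum.inter_filter[symmetric]) auto
  from this[of "C 3 _"] this[of "{u. u \<noteq> 0}"] show ?thesis
    using sum_C3[of "\<lambda>u. if Q u then f u else 0"] by simp
qed

text \<open>The classes of \<open>u\<close> cover everything but \<open>u = 0\<close>, where
  \<open>quad\<close> vanishes; then \<open>u\<close> is replaced by \<open>1 - u\<close>.\<close>

lemma sum_\<sigma>_left: "\<sigma> 0 j + \<sigma> 1 j + \<sigma> 2 j = jac j"
proof -
  have "\<sigma> 0 j + \<sigma> 1 j + \<sigma> 2 j = (\<Sum>u | u \<noteq> 0 \<and> 1 - u \<in> C 3 j. quad u)"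
    unfolding \<sigma>_def P_def by (rule sum_C3_filter)
  also have "\<dots> = (\<Sum>u | 1 - u \<in> C 3 j. quad u)"
    by (rule sum.mono_neutral_left) auto
  also have "\<dots> = jac j"
    unfolding jac_def
    by (rule sum.reindex_bij_witness[where i = "\<lambda>u. 1 - u" and j = "\<lambda>u. 1 - u"]) auto
  finally show ?thesis .
qed

lemma sum_P_right:
  fixes f :: "'a \<Rightarrow> 'b::comm_monoid_add"
  shows "sum f (P i 0) + sum f (P i 1) + sum f (P i 2) = sum f (C 3 i - {1})"
proof -
  have P: "sum f (P i j) = (\<Sum>w | w \<in> C 3 j \<and> 1 - w \<in> C 3 i. f (1 - w))" for j
    unfolding P_def
    by (rule sum.reindex_bij_witness[where i = "\<lambda>u. 1 - u" and j = "\<lambda>u. 1 - u"]) auto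
  have "sum f (P i 0) + sum f (P i 1) + sum f (P i 2) = (\<Sum>w | w \<noteq> 0 \<and> 1 - w \<in> C 3 i. f (1 - w))"
    unfolding P by (rule sum_C3_filter)
  also have "\<dots> = sum f (C 3 i - {1})"
    by (rule sum.reindex_bij_witness[where i = "\<lambda>u. 1 - u" and j = "\<lambda>u. 1 - u"]) auto
  finally show ?thesis .
qed

text \<open>Multiplication by the nonsquare cube \<open>\<omega> ^ 3\<close> preserves a cubic class
  and negates \<open>quad\<close>.\<close>

lemma sum_quad_C3: "(\<Sum>u\<in>C 3 i. quad u) = 0"
proof -
  have "\<omega> ^ 3 \<in> C 3 0" using power_in_C[OF three_dvd_N gen_nonzero] .
  from bij_betw_C[OF three_dvd_N this, of i]
  have "(\<Sum>u\<in>C 3 i. quad u) = (\<Sum>u\<in>C 3 i. quad (\<omega> ^ 3 * u))"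
    by (intro sum.reindex_bij_betw[symmetric]) simp
  also have "\<dots> = - (\<Sum>u\<in>C 3 i. quad u)"
    by (simp add: quad_mult quad_power quad_gen sum_negf)
  finally show ?thesis by simp
qed

lemma sum_\<sigma>_1: "\<sigma> 1 0 + \<sigma> 1 1 + \<sigma> 1 2 = 0"
proof -
  have "C 3 1 - {1} = C 3 1"
    using in_C3_unique[OF one_in_C[OF three_dvd_N], of 1] by (simp add: cong_def)
  then show ?thesis unfolding \<sigma>_def sum_P_right using sum_quad_C3[of 1] by simp
qed

lemma two_neq_0: "(2::'a) \<noteq> 0"
proof
  assume "(2::'a) = 0"
  then have "CHAR('a) dvd 2" using of_nat_eq_0_iff_char_dvd[of 2, where 'a = 'a] by simp
  then have "CHAR('a) = 2" using two_is_prime_nat CHAR_not_1' by (auto simp: prime_nat_iff)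
  then have "even CARD('a)" using CHAR_dvd_CARD[where 'a = 'a] by simp
  then show False using even_N card_eq_Suc_N by simp
qed

text \<open>\<open>1 - 4v\<close> is the discriminant of \<open>u\<^sup>2 - u + v\<close>.\<close>

lemma card_factorizations: "int (card {u. u * (1 - u) = v}) = 1 + quad (1 - 4 * v)"
proof -
  have "bij_betw (\<lambda>u. 1 - 2 * u) {u. u * (1 - u) = v} {y. y\<^sup>2 = 1 - 4 * v}"
  proof (rule bij_betwI[where g = "\<lambda>y. (1 - y) / 2"])
    show "(\<lambda>y. (1 - y) / 2) \<in> {y. y\<^sup>2 = 1 - 4 * v} \<rightarrow> {u. u * (1 - u) = v}"
    proof safe
      fix y assume y: "y\<^sup>2 = 1 - 4 * v"
      have "(1 - y) / 2 * (1 - (1 - y) / 2) = (1 - y\<^sup>2) / (2 * 2)"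
        using two_neq_0 by (simp add: power2_eq_square divide_simps) (simp add: algebra_simps)
      also have "\<dots> = (2 * 2) * v / (2 * 2)" unfolding y by simp
      also have "\<dots> = v"
      proof (rule nonzero_mult_div_cancel_left)
        show "(2::'a) * 2 \<noteq> 0" using two_neq_0 by (simp only: mult_eq_0_iff) simp
      qed
      finally show "(1 - y) / 2 * (1 - (1 - y) / 2) = v" .
    qed
    show "(\<lambda>u. 1 - 2 * u) \<in> {u. u * (1 - u) = v} \<rightarrow> {y. y\<^sup>2 = 1 - 4 * v}"
    proof
      fix u assume "u \<in> {u. u * (1 - u) = v}"
      then have v: "v = u * (1 - u)" by simp
      show "1 - 2 * u \<in> {y. y\<^sup>2 = 1 - 4 * v}"
        unfolding v by (simp add: power2_eq_square algebra_simps)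
    qed
    show "(1 - (1 - 2 * u)) / 2 = u" for u :: 'a using two_neq_0 by simp
    show "1 - 2 * ((1 - y) / 2) = y" for y :: 'a
      unfolding times_divide_eq_right nonzero_mult_div_cancel_left[OF two_neq_0] by simp
  qed
  from bij_betw_same_card[OF this] show ?thesis by (simp add: card_sqrt)
qed

text \<open>The three sets partition the \<open>u\<close> with \<open>u * (1 - u)\<close> in
  \<open>C 3 i\<close>; grouping them by \<open>v = u * (1 - u)\<close> brings in the number of
  solutions \<open>u\<close> for each \<open>v\<close>.\<close>

lemma sum_factorizations:
  fixes f :: "'a \<Rightarrow> int"
  shows "(\<Sum>u\<in>P 0 i. f (u * (1 - u))) + (\<Sum>u\<in>P 1 (i - 1). f (u * (1 - u))) + (\<Sum>u\<in>P 2 (i - 2). f (u * (1 - u)))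
    = (\<Sum>v\<in>C 3 i. f v * (1 + quad (1 - 4 * v)))"
proof -
  have P: "P j (i - j) = {u. u \<in> C 3 j \<and> u * (1 - u) \<in> C 3 i}" for j
    using mult_in_C_iff[OF three_dvd_N] by (auto simp: P_def)
  have "(\<Sum>u\<in>P 0 i. f (u * (1 - u))) + (\<Sum>u\<in>P 1 (i - 1). f (u * (1 - u))) + (\<Sum>u\<in>P 2 (i - 2). f (u * (1 - u)))
      = (\<Sum>u | u \<noteq> 0 \<and> u * (1 - u) \<in> C 3 i. f (u * (1 - u)))"
    unfolding P[of 0, simplified] P by (rule sum_C3_filter)
  also have "{u. u \<noteq> 0 \<and> u * (1 - u) \<in> C 3 i} = {u. u * (1 - u) \<in> C 3 i}"
    by (auto dest: C_nonzero)
  also have "(\<Sum>u | u * (1 - u) \<in> C 3 i. f (u * (1 - u))) =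
      (\<Sum>v\<in>C 3 i. \<Sum>u | u \<in> {u. u * (1 - u) \<in> C 3 i} \<and> u * (1 - u) = v. f (u * (1 - u)))"
    by (rule sum.group[symmetric]) auto
  also have "\<dots> = (\<Sum>v\<in>C 3 i. f v * (1 + quad (1 - 4 * v)))"
  proof (rule sum.cong)
    fix v assume v: "v \<in> C 3 i"
    have "(\<Sum>u | u \<in> {u. u * (1 - u) \<in> C 3 i} \<and> u * (1 - u) = v. f (u * (1 - u))) =
        (\<Sum>u | u * (1 - u) = v. f v)"
      using v by (intro sum.cong) auto
    then show "(\<Sum>u | u \<in> {u. u * (1 - u) \<in> C 3 i} \<and> u * (1 - u) = v. f (u * (1 - u))) =
        f v * (1 + quad (1 - 4 * v))"
      by (simp flip: card_factorizations)
  qed simp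
  finally show ?thesis .
qed

text \<open>\<open>u * (1 - u)\<close> and \<open>1 - inverse u\<close> differ by a square factor
  and a sign, so inversion followed by the swap of \<open>u\<close> and \<open>1 - u\<close> reduces
  the sum to \<sigma>.\<close>

lemma sum_quad_P: "(\<Sum>u\<in>P j k. quad (u * (1 - u))) = \<sigma> (k - j) (- j)"
proof -
  have "(\<Sum>u\<in>P j k. quad (u * (1 - u))) = (\<Sum>u\<in>P j k. quad (1 - inverse u))"
  proof (rule sum.cong)
    fix u assume "u \<in> P j k"
    then have "u \<noteq> 0" by (auto simp: P_def C_def)
    then have "1 - inverse u = - ((1 - u) / u)" by (simp add: field_simps)
    then show "quad (u * (1 - u)) = quad (1 - inverse u)"
      by (simp only: quad_uminus quad_divide quad_mult mult.commute)
  qed simp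
  also have "\<dots> = (\<Sum>u\<in>P (- j) (k - j). quad (1 - u))"
    by (rule sum.reindex_bij_betw[OF bij_betw_P_inverse])
  also have "\<dots> = \<sigma> (k - j) (- j)"
    unfolding \<sigma>_def by (rule sum.reindex_bij_betw[OF bij_betw_P_swap])
  finally show ?thesis .
qed

text \<open>As 2 is a cube, so is 4, and multiplication by 4 permutes each cubic class.\<close>

lemma sum_C3_scale_4:
  fixes f :: "'a \<Rightarrow> 'b::comm_monoid_add"
  assumes "\<exists>y::'a. y ^ 3 = 2"
  shows "(\<Sum>v\<in>C 3 i. f (4 * v)) = sum f (C 3 i)"
proof -
  obtain y :: 'a where y: "y ^ 3 = 2" using assms by blast
  then have "y\<^sup>2 \<noteq> 0" using two_neq_0 by auto
  from power_in_C[OF three_dvd_N this] have "(y ^ 3)\<^sup>2 \<in> C 3 0" by (simp flip: power_mult)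
  then have "4 \<in> C 3 0" unfolding y by simp
  from bij_betw_C[OF three_dvd_N this, of i] show ?thesis
    by (intro sum.reindex_bij_betw) simp
qed

text \<open>\<open>sum_factorizations\<close> for \<open>quad\<close>: the twist by 4 disappears by
  scaling, and \<open>v \<mapsto> inverse v\<close> turns what is left into a value of
  \<open>jac\<close>.\<close>

lemma sum_\<sigma>_factorizations:
  assumes "\<exists>y::'a. y ^ 3 = 2"
  shows "\<sigma> i 0 + \<sigma> (i - 2) (- 1) + \<sigma> (i - 4) (- 2) = jac (- i)"
proof -
  have "\<sigma> i 0 + \<sigma> (i - 2) (- 1) + \<sigma> (i - 4) (- 2) = (\<Sum>v\<in>C 3 i. quad v * (1 + quad (1 - 4 * v)))"
    using sum_factorizations[of quad i] unfolding sum_quad_P by simp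
  also have "\<dots> = (\<Sum>v\<in>C 3 i. quad v * quad (1 - 4 * v))"
    using sum_quad_C3[of i] by (simp add: distrib_left sum.distrib)
  also have "\<dots> = (\<Sum>v\<in>C 3 i. quad (4 * v) * quad (1 - 4 * v))"
  proof -
    have "quad 4 = 1" using quad_square[OF two_neq_0] by (simp flip: quad_mult)
    then show ?thesis by (simp add: quad_mult)
  qed
  also have "\<dots> = (\<Sum>v\<in>C 3 i. quad v * quad (1 - v))"
    using sum_C3_scale_4[OF assms, of "\<lambda>v. quad v * quad (1 - v)"] .
  also have "\<dots> = (\<Sum>v\<in>C 3 (- i). quad (1 - v))"
  proof (rule sum.reindex_bij_witness[where i = inverse and j = inverse])
    fix v assume "v \<in> C 3 i"
    then have "v \<noteq> 0" by (rule C_nonzero)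
    then have "1 - inverse v = - ((1 - v) / v)" by (simp add: field_simps)
    then show "quad (1 - inverse v) = quad v * quad (1 - v)"
      by (simp only: quad_uminus quad_divide mult.commute)
  qed (use C3_closed(2)[of _ i] C3_closed(2)[of _ "- i"] in auto)
  finally show ?thesis by (simp add: jac_def)
qed

lemma sum_card_P_factorizations:
  assumes "\<exists>y::'a. y ^ 3 = 2"
  shows "int (card (P 0 i)) + int (card (P 1 (i - 1))) + int (card (P 2 (i - 2))) = int (card (C 3 i)) + jac i"
  using sum_factorizations[of "\<lambda>_. 1" i] sum_C3_scale_4[OF assms, of "\<lambda>v. quad (1 - v)" i]
  by (simp add: sum.distrib jac_def)

text \<open>The count is half of \<open>card (P 0 i) - \<sigma> 0 i\<close>. The symmetries, the
  marginal sums and the factorization counts form linear systems that determine both terms, and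
  their difference is independent of \<open>i\<close>.\<close>

lemma card_nonsquare_P:
  assumes two: "\<exists>y::'a. y ^ 3 = 2" and s0: "jac 0 = - 1"
  shows "18 * card {u \<in> P 0 i. quad u = - 1} = N"
proof -
  define f where "f = int N div 3"
  have f: "int (card (C 3 i)) = f" for i
    using card_C[OF three_dvd_N, of i] unfolding f_def by simp
  have \<sigma>_eq: "\<sigma> i j = \<sigma> i' j'" if "[i = i'] (mod 3)" "[j = j'] (mod 3)" for i j i' j'
    using P_cong[OF that] by (simp add: \<sigma>_def)
  \<comment> \<open>Inversion leaves only the six unknowns \<open>\<sigma> 0 j\<close> and
    \<open>\<sigma> 1 j\<close>.\<close>
  have eq: "\<sigma> 2 2 = \<sigma> 1 0" "\<sigma> 2 0 = \<sigma> 1 1" "\<sigma> 2 1 = \<sigma> 1 2"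
    by (subst \<sigma>_inverse, rule \<sigma>_eq; simp add: cong_def)+
  have s12: "jac 1 + jac 2 = 0" using sum_jac s0 by simp
  have a: "\<sigma> 0 0 + \<sigma> 1 0 + \<sigma> 1 1 = - 1" "\<sigma> 0 1 + \<sigma> 1 1 + \<sigma> 1 2 = jac 1" "\<sigma> 0 2 + \<sigma> 1 2 + \<sigma> 1 0 = jac 2"
    using sum_\<sigma>_left[of 0] sum_\<sigma>_left[of 1] sum_\<sigma>_left[of 2] s0 eq by simp_all
  have b: "\<sigma> 0 0 + 2 * \<sigma> 1 2 = - 1" "2 * \<sigma> 1 0 + \<sigma> 0 1 = jac 2" "2 * \<sigma> 1 1 + \<sigma> 0 2 = jac 1"
  proof -
    have "\<sigma> (- 2) (- 1) = \<sigma> 1 2" "\<sigma> (- 4) (- 2) = \<sigma> 2 1" "\<sigma> (- 1) (- 1) = \<sigma> 2 2" "\<sigma> (- 3) (- 2) = \<sigma> 0 1"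
      "\<sigma> 0 (- 1) = \<sigma> 0 2" "\<sigma> (- 2) (- 2) = \<sigma> 1 1" "jac (- 1) = jac 2" "jac (- 2) = jac 1"
      by (auto intro!: \<sigma>_eq jac_cong simp: cong_def)
    then show "\<sigma> 0 0 + 2 * \<sigma> 1 2 = - 1" "2 * \<sigma> 1 0 + \<sigma> 0 1 = jac 2" "2 * \<sigma> 1 1 + \<sigma> 0 2 = jac 1"
      using sum_\<sigma>_factorizations[OF two, of 0] sum_\<sigma>_factorizations[OF two, of 1]
        sum_\<sigma>_factorizations[OF two, of 2] eq s0 by simp_all
  qed
  have sig: "\<sigma> 0 0 = - 1" "3 * \<sigma> 0 1 = jac 1" "3 * \<sigma> 0 2 = jac 2"
    using a b sum_\<sigma>_1 s12 by linarith+
  define n where "n i j = int (card (P i j))" for i j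
  have n_eq: "n i j = n i' j'" if "[i = i'] (mod 3)" "[j = j'] (mod 3)" for i j i' j'
    using P_cong[OF that] by (simp add: n_def)
  have n_swap: "n i j = n j i" and n_inv: "n i j = n (- i) (j - i)" for i j
    using card_P_swap[of i j] card_P_inverse[of i j] by (simp_all add: n_def)
  have "n 1 0 = n 0 1" "n 2 0 = n 0 2" by (rule n_swap)+
  moreover have "n 2 2 = n 1 0" "n 1 1 = n 2 0"
    by (subst n_inv, rule n_eq; simp add: cong_def)+
  \<comment> \<open>Swap and inversion identify \<open>n 0 1\<close>, \<open>n 1 0\<close>,
    \<open>n 2 2\<close>, and likewise \<open>n 0 2\<close>, \<open>n 2 0\<close>,
    \<open>n 1 1\<close>, so each factorization count below is three times one number.\<close>
  moreover have "n 2 (- 1) = n 2 2" by (rule n_eq) (simp_all add: cong_def)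
  moreover have "n 0 1 + n 1 0 + n 2 (- 1) = f + jac 1" "n 0 2 + n 1 1 + n 2 0 = f + jac 2"
    using sum_card_P_factorizations[OF two, of 1] sum_card_P_factorizations[OF two, of 2]
    by (simp_all add: f n_def)
  ultimately have n12: "3 * n 0 1 = f + jac 1" "3 * n 0 2 = f + jac 2" by linarith+
  have "n 0 0 + n 0 1 + n 0 2 = f - 1"
  proof -
    have "1 \<in> C 3 0" by (rule one_in_C[OF three_dvd_N])
    moreover from this have "card (C 3 0) > 0" by (auto simp: card_gt_0_iff)
    ultimately show ?thesis
      using sum_P_right[of "\<lambda>_. 1::int" 0] f[of 0] by (simp add: n_def of_nat_diff)
  qed
  with n12 s12 have n0: "3 * n 0 0 = f - 3" by linarith
  \<comment> \<open>The terms \<open>jac i\<close> cancel for \<open>i\<close> = 1, 2; for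
    \<open>i\<close> = 0 the -3 in \<open>n0\<close> cancels against
    \<open>\<sigma> 0 0 = - 1\<close>.\<close>
  have uniform: "3 * (n 0 i - \<sigma> 0 i) = f"
  proof -
    have "[i = 0] (mod 3) \<or> [i = 1] (mod 3) \<or> [i = 2] (mod 3)"
      unfolding cong_def by (simp; presburger)
    then show ?thesis
      using n_eq[of 0 0 i] \<sigma>_eq[of 0 0 i] n0 n12 sig by (smt (verit) cong_refl)
  qed
  have "n 0 i - \<sigma> 0 i = (\<Sum>u\<in>P 0 i. 1 - quad u)"
    by (simp add: n_def \<sigma>_def sum_subtractf)
  also have "\<dots> = (\<Sum>u\<in>P 0 i. if quad u = - 1 then 2 else 0)"
  proof (rule sum.cong)
    fix u assume "u \<in> P 0 i"
    then have "u \<noteq> 0" by (auto simp: P_def C_def)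
    then show "1 - quad u = (if quad u = - 1 then 2 else 0)" using quad_cases[of u] by auto
  qed simp
  also have "\<dots> = 2 * int (card {u \<in> P 0 i. quad u = - 1})"
    by (simp flip: sum.inter_filter)
  finally have "6 * int (card {u \<in> P 0 i. quad u = - 1}) = f" using uniform by simp
  moreover have "3 * f = int N" using three_dvd_N unfolding f_def by (simp flip: int_dvd_int_iff)
  ultimately show ?thesis by linarith
qed

lemma in_C6_iff: "x \<in> C 6 i \<longleftrightarrow> x \<in> C 3 i \<and> (even (ind x) \<longleftrightarrow> even i)"
proof -
  have "[ind x = i] (mod 6) \<longleftrightarrow> [ind x = i] (mod 3) \<and> (even (ind x) \<longleftrightarrow> even i)"
    unfolding cong_iff_dvd_diff by presburger
  then show ?thesis by (auto simp: C_def)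
qed

text \<open>The nonsquares of \<open>P 0 i\<close> lie in \<open>C 6 3\<close>, and
  \<open>u - 1\<close> lies in class \<open>i\<close> or \<open>i - 3\<close> of order six.
  Inversion exchanges the two cases, because \<open>inverse u - 1\<close> is
  \<open>- (u - 1) / u\<close> and \<open>u\<close> has class 3; so each case is half of the
  previous count.\<close>

lemma card_cyclotomic:
  assumes two: "\<exists>y::'a. y ^ 3 = 2" and s0: "jac 0 = - 1"
  shows "36 * card {u \<in> C 6 3. u - 1 \<in> C 6 i} = N"
proof -
  define T where "T i = {u \<in> C 6 3. u - 1 \<in> C 6 i}" for i
  have inv: "inverse u \<in> T (i - 3)" if "u \<in> T i" for u i
  proof -
    have u: "u \<in> C 6 3" "u - 1 \<in> C 6 i" using that by (auto simp: T_def)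
    have "inverse u - 1 = - 1 * ((u - 1) / u)" using C_nonzero[OF u(1)] by (simp add: field_simps)
    also have "\<dots> \<in> C 6 (0 + (i - 3))"
      by (intro C_mult[OF six_dvd_N] minus_one_in_C C_divide[OF six_dvd_N] u)
    finally have "inverse u - 1 \<in> C 6 (i - 3)" by simp
    moreover have "inverse u \<in> C 6 3"
      using C_inverse[OF six_dvd_N u(1)] C_cong[of "- 3" 3 6] by (simp add: cong_def)
    ultimately show ?thesis by (simp add: T_def)
  qed
  have T6: "T (i - 6) = T i" for i
    using C_cong[of "i - 6" i 6] by (simp add: T_def cong_iff_dvd_diff)
  have "bij_betw inverse (T i) (T (i - 3))"
  proof (rule bij_betwI[where g = inverse])
    show "inverse \<in> T (i - 3) \<rightarrow> T i" using inv[of _ "i - 3"] T6[of i] by auto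
  qed (auto intro: inv)
  then have same: "card (T (i - 3)) = card (T i)" by (rule bij_betw_same_card[symmetric])
  have "{u \<in> P 0 i. quad u = - 1} = T i \<union> T (i - 3)"
  proof (intro Set.set_eqI iffI)
    fix u
    have "C 3 3 = C 3 0" "C 3 (i - 3) = C 3 i" by (auto intro!: C_cong simp: cong_def)
    moreover have "1 - u \<in> C 3 i \<longleftrightarrow> u - 1 \<in> C 3 i" by (rule diff_in_C3)
    moreover have "quad u = - 1 \<longleftrightarrow> u \<noteq> 0 \<and> odd (ind u)" by (auto simp: quad_def)
    moreover have "u \<in> C 3 0 \<Longrightarrow> u \<noteq> 0" by (rule C_nonzero)
    ultimately show "u \<in> {u \<in> P 0 i. quad u = - 1} \<Longrightarrow> u \<in> T i \<union> T (i - 3)"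
      and "u \<in> T i \<union> T (i - 3) \<Longrightarrow> u \<in> {u \<in> P 0 i. quad u = - 1}"
      by (auto simp: T_def P_def in_C6_iff)
  qed
  moreover have "T i \<inter> T (i - 3) = {}" by (auto simp: T_def in_C6_iff)
  ultimately have "card {u \<in> P 0 i. quad u = - 1} = card (T i) + card (T i)"
    using card_Un_disjoint[of "T i" "T (i - 3)"] same by simp
  with card_nonsquare_P[OF assms, of i] show ?thesis by (simp add: T_def)
qed

end

section \<open>Cayley digraphs of semidirect products\<close>

text \<open>Right translation by \<open>inv x\<close> turns the walks \<open>x, z, y\<close> into
  factorizations of \<open>y \<otimes> inv x\<close> with both factors in \<open>W\<close>. The
  walks with \<open>y = x\<close> are the reciprocal arcs at \<open>x\<close>, which is why the
  identity yields \<open>t\<close>.\<close>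

lemma (in group) cayley_directed_strongly_regular:
  assumes fin: "finite (carrier G)" and W: "W \<subseteq> carrier G" "\<one> \<notin> W"
    and count: "\<And>g. g \<in> carrier G \<Longrightarrow>
      card {w \<in> W. g \<otimes> inv w \<in> W} = (if g = \<one> then t else if g \<in> W then l else m)"
  shows "directed_strongly_regular (cayley G W) (card (carrier G)) (card W) l m t"
proof -
  define D where "D = cayley G W"
  have V: "pverts D = carrier G" by (simp add: D_def cayley_def)
  have arc: "(x, y) \<in> parcs D \<longleftrightarrow> x \<in> carrier G \<and> y \<in> carrier G \<and> y \<otimes> inv x \<in> W" for x y
    by (simp add: D_def cayley_def)
  have "parcs D \<subseteq> carrier G \<times> carrier G" using arc by auto
  then have "finite (parcs D)" by (rule finite_subset) (use fin in simp)
  moreover have "fst e \<noteq> snd e" if "e \<in> parcs D" for e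
    using that arc[of "fst e" "snd e"] W(2) by (auto simp: r_inv)
  ultimately have digraph: "pair_digraph D"
    using arc V fin by unfold_locales (auto simp: arc split_paired_all)
  have out: "card {y \<in> carrier G. (x, y) \<in> parcs D} = card W" if "x \<in> carrier G" for x
    by (rule bij_betw_same_card[OF bij_betwI[where f = "\<lambda>y. y \<otimes> inv x" and g = "\<lambda>w. w \<otimes> x"]])
       (use W that in \<open>auto simp: arc m_assoc\<close>)
  have cancel: "x \<otimes> (inv x \<otimes> w) = w" "inv x \<otimes> (x \<otimes> w) = w" if "x \<in> carrier G" "w \<in> carrier G" for x w
    using that by (simp_all flip: m_assoc)
  have "in": "card {y \<in> carrier G. (y, x) \<in> parcs D} = card W" if "x \<in> carrier G" for x
    by (rule bij_betw_same_card[OF bij_betwI[where f = "\<lambda>y. x \<otimes> inv y" and g = "\<lambda>w. inv w \<otimes> x"]])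
       (use W that cancel in \<open>auto simp: arc m_assoc inv_mult_group subset_iff\<close>)
  have mid: "card {z \<in> carrier G. (x, z) \<in> parcs D \<and> (z, y) \<in> parcs D} =
      card {w \<in> W. (y \<otimes> inv x) \<otimes> inv w \<in> W}" if "x \<in> carrier G" "y \<in> carrier G" for x y
    by (rule bij_betw_same_card[OF bij_betwI[where f = "\<lambda>z. z \<otimes> inv x" and g = "\<lambda>w. w \<otimes> x"]])
       (use W that cancel in \<open>auto simp: arc m_assoc inv_mult_group subset_iff\<close>)
  show ?thesis
    unfolding directed_strongly_regular_def D_def[symmetric] V
  proof (intro conjI ballI impI)
    fix x assume x: "x \<in> carrier G"
    show "card {y \<in> carrier G. (x, y) \<in> parcs D \<and> (y, x) \<in> parcs D} = t"
      using mid[OF x x] count[of \<one>] x by simp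
    fix y assume y: "y \<in> carrier G" "x \<noteq> y"
    then have "y \<otimes> inv x \<noteq> \<one>" using x inv_solve_right'[of \<one> y x] by auto
    then show "card {z \<in> carrier G. (x, z) \<in> parcs D \<and> (z, y) \<in> parcs D} =
        (if (x, y) \<in> parcs D then l else m)"
      using mid[OF x y(1)] count[of "y \<otimes> inv x"] x y by (simp add: arc)
  qed (simp_all add: digraph out "in")
qed

section \<open>Multiplications as automorphisms of the additive group of a field\<close>

lemma field_rec_simps [simp]:
  "carrier (field_rec :: 'a::field ring) = UNIV" "\<one>\<^bsub>(field_rec :: 'a::field ring)\<^esub> = 1"
  "\<zero>\<^bsub>(field_rec :: 'a::field ring)\<^esub> = 0" "x \<otimes>\<^bsub>(field_rec :: 'a::field ring)\<^esub> y = x * y"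
  "x \<oplus>\<^bsub>(field_rec :: 'a::field ring)\<^esub> y = x + y"
  by (simp_all add: ring_of_type_algebra_def)

lemma group_field_units: "group (field_units :: 'a::field monoid)"
  by (rule field.field_mult_group[OF field_from_type_algebra])

lemma group_field_add: "group (add_monoid (field_rec :: 'a::field ring))"
proof -
  interpret ring "field_rec :: 'a ring" by (rule ring_from_type_algebra)
  show ?thesis by (rule add.is_group)
qed

lemma nat_pow_field_units: "x [^]\<^bsub>(field_units :: 'a::field monoid)\<^esub> (k::nat) = x ^ k"
  by (induction k) (simp_all add: Multiplicative_Group.mult_of_def nat_pow_def mult.commute)

lemma generate_field_units:
  fixes x :: "'a::{field,finite}"
  assumes "x \<noteq> 0"
  shows "generate field_units {x} = range (\<lambda>k. x ^ k)"
  using group.generate_pow_on_finite_carrier[OF group_field_units, of x] assms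
  by (auto simp: nat_pow_field_units)

definition scale :: "'a::field \<Rightarrow> 'a \<Rightarrow> 'a" where
  "scale c = (\<lambda>x. c * x)"

lemma scale_eq_iff: "scale c = scale d \<longleftrightarrow> c = d"
proof
  assume "scale c = scale d"
  then have "scale c 1 = scale d 1" by simp
  then show "c = d" by (simp add: scale_def)
qed simp

lemma scale_in_auto:
  fixes c :: "'a::field"
  assumes "c \<noteq> 0"
  shows "scale c \<in> auto (add_monoid field_rec)"
proof -
  have "bij (scale c)"
    by (rule o_bij[where g = "scale (inverse c)"]) (use assms in \<open>auto simp: scale_def fun_eq_iff\<close>)
  then show ?thesis
    by (auto simp: auto_def hom_def Bij_def scale_def algebra_simps)
qed

lemma scale_hom: "scale \<in> hom field_units (AutoGroup (add_monoid (field_rec :: 'a::field ring)))"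
  using scale_in_auto[where 'a = 'a]
  by (auto simp: hom_def AutoGroup_def BijGroup_def auto_def compose_def scale_def fun_eq_iff mult.assoc)

lemma scale_mult:
  fixes c d :: "'a::field"
  assumes "c \<noteq> 0" "d \<noteq> 0"
  shows "scale c \<otimes>\<^bsub>AutoGroup (add_monoid field_rec)\<^esub> scale d = scale (c * d)"
  using scale_hom[where 'a = 'a] assms by (simp add: hom_def)

lemma scale_one: "\<one>\<^bsub>AutoGroup (add_monoid (field_rec :: 'a::field ring))\<^esub> = scale 1"
  by (simp add: AutoGroup_def BijGroup_def scale_def restrict_def)

text \<open>A homomorphism carries generated subgroups to generated subgroups; this identifies
  \<open>K\<close> with a group of field elements.\<close>

lemma generate_scale:
  fixes c :: "'a::field"
  assumes "c \<noteq> 0"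
  shows "generate (AutoGroup (add_monoid field_rec)) {scale c} = scale ` generate field_units {c}"
proof -
  interpret group_hom "field_units :: 'a monoid" "AutoGroup (add_monoid (field_rec :: 'a ring))" scale
    by (intro group_hom.intro group_hom_axioms.intro group_field_units scale_hom
        group.AutoGroup group_field_add)
  show ?thesis using generate_img[of "{c}"] assms by simp
qed

context finite_field_generator
begin

text \<open>Links the classes defined by discrete logarithms to generated subgroups; in a finite
  group natural exponents suffice for generation.\<close>

lemma C_eq_generate:
  assumes e: "e dvd N"
  shows "C e 0 = generate field_units {\<omega> ^ e}"
proof -
  have "x \<in> C e 0 \<longleftrightarrow> (\<exists>k. x = (\<omega> ^ e) ^ k)" for x
  proof
    assume "x \<in> C e 0"
    then have x: "x \<noteq> 0" "int e dvd ind x" by (auto simp: C_def cong_0_iff)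
    then have "e dvd nat (ind x)" using ind_nonneg by (metis int_dvd_int_iff nat_0_le)
    then obtain k where "nat (ind x) = e * k" by (elim dvdE)
    with gen_power_ind[OF x(1)] show "\<exists>k. x = (\<omega> ^ e) ^ k" by (metis power_mult)
  next
    assume "\<exists>k. x = (\<omega> ^ e) ^ k"
    then obtain k where "x = (\<omega> ^ k) ^ e" by (auto simp: mult.commute simp flip: power_mult)
    then show "x \<in> C e 0" using power_in_C[OF e] gen_nonzero by simp
  qed
  then show ?thesis using gen_nonzero by (auto simp: generate_field_units)
qed

end

lemma finite_field_generator_primitive_element:
  fixes \<omega> :: "'a::{field,finite}"
  assumes "primitive_element \<omega>"
  shows "finite_field_generator \<omega> (CARD('a) - 1)"
proof
  have \<omega>: "\<omega> \<noteq> 0" using assms by (simp add: primitive_element_def)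
  have "range (\<lambda>k. \<omega> ^ k) = UNIV - {0}"
    using assms unfolding primitive_element_def generate_field_units[OF \<omega>] by simp
  then show "x \<noteq> 0 \<Longrightarrow> \<exists>k. x = \<omega> ^ k" for x by blast
  show "\<omega> \<noteq> 0" by (rule \<omega>)
  show "CARD('a) = Suc (CARD('a) - 1)" using zero_less_card_finite[where 'a = 'a] by simp
qed

theorem theorem4p6:
  fixes \<omega> :: "'a::{field,finite}"
    and b :: int and q :: nat
    and H :: "'a monoid" and C0 C3 :: "'a set"
    and \<rho> :: "'a \<Rightarrow> 'a" and K :: "('a \<Rightarrow> 'a) set"
    and G :: "('a \<times> ('a \<Rightarrow> 'a)) monoid" and W :: "('a \<times> ('a \<Rightarrow> 'a)) set"
  assumes "q = CARD('a)" and "primepow q"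
    and "int q = 1 + 3 * b ^ 2" and "even b"
    and "\<exists>y::'a. y ^ 3 = 2"
    and "primitive_element \<omega>"
    and "C0 = generate field_units {\<omega> ^ 6}"
    and "C3 = (\<lambda>c. \<omega> ^ 3 * c) ` C0"
    and "H = add_monoid field_rec"
    and "\<rho> = (\<lambda>x. \<omega> ^ 6 * x)"
    and "K = generate (AutoGroup H) {\<rho>}"
    and "G = semidirect H K"
    and "W = {(- 1 + c, \<phi>) | c \<phi>. c \<in> C3 \<and> \<phi> \<in> K}"
  shows "W \<subseteq> carrier G \<and>
    (\<exists>v k l m t :: nat.
       directed_strongly_regular (cayley G W) v k l m t \<and>
       real v = (real q - 1) * real q / 6 \<and>
       real k = (real q - 1) ^ 2 / 36 \<and>
       real l = (real q - 1) ^ 2 / 216 - (real q - 1) / 36 \<and>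
       real m = (real q - 1) ^ 2 / 216 \<and>
       real t = (real q - 1) ^ 2 / 216)"
proof -
  define N where "N = q - 1"
  \<comment> \<open>As \<open>b\<close> is even, \<open>q - 1 = 3 * b ^ 2\<close> is a multiple of
    12.\<close>
  have "int q = 1 + 12 * (b div 2)\<^sup>2"
    using assms(3,4) by (auto elim!: evenE simp: power_mult_distrib)
  moreover have "q \<ge> 1" using assms(1) zero_less_card_finite[where 'a = 'a] by simp
  ultimately have "int N = 12 * (b div 2)\<^sup>2" by (simp add: N_def of_nat_diff)
  then have "int 12 dvd int N" by simp
  then have "12 dvd N" unfolding int_dvd_int_iff .
  then interpret finite_field_generator_12 \<omega> N
    using finite_field_generator_primitive_element[OF assms(6)] assms(1)
    by (simp add: finite_field_generator_12_def finite_field_generator_12_axioms_def N_def)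
  have s0: "jac 0 = - 1" using jac_0_eq_minus_one assms(1-4) by simp
  have C0: "C0 = C 6 0" using C_eq_generate[OF six_dvd_N] assms(7) by simp
  have C3: "C3 = C 6 3"
    using bij_betw_C[OF six_dvd_N gen_power_in_C[OF six_dvd_N, of 3], of 0]
    unfolding assms(8) C0 bij_betw_def by simp
  have \<rho>: "\<rho> = scale (\<omega> ^ 6)" by (simp add: assms(10) scale_def)
  have K: "K = scale ` C 6 0"
    using generate_scale[of "\<omega> ^ 6"] gen_nonzero assms(7) C0 unfolding assms(11,9) \<rho> by simp
  define S where "S = (\<lambda>c. - 1 + c) ` C 6 3"
  have S_iff: "x \<in> S \<longleftrightarrow> x + 1 \<in> C 6 3" for x
    by (auto simp: S_def image_iff intro: bexI[of _ "x + 1"])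
  have W: "W = S \<times> scale ` C 6 0" unfolding assms(13) K C3 S_def by auto
  obtain f where f: "N = 36 * f" using card_cyclotomic[OF assms(5) s0, of 0] by metis
  have f_card: "card {u \<in> C 6 3. u - 1 \<in> C 6 i} = f" for i
    using card_cyclotomic[OF assms(5) s0, of i] f by simp
  have card_C6: "card (C 6 i) = 6 * f" for i using card_C[OF six_dvd_N, of i] f by simp
  have card_S: "card S = 6 * f" unfolding S_def by (subst card_image) (auto simp: card_C6)
  have card_K: "card (scale ` C 6 0) = 6 * f"
    by (subst card_image) (auto simp: card_C6 inj_on_def scale_eq_iff)
  \<comment> \<open>0 in \<open>S\<close> would put 1 in \<open>C 6 3\<close>. Hence the identity is
    outside \<open>W\<close>, and division by elements of \<open>S\<close> is safe.\<close>
  have zero_S: "0 \<notin> S"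
    using C_unique[OF one_in_C[OF six_dvd_N], of 3] by (auto simp: S_iff cong_def)
  interpret H: group H unfolding assms(9) by (rule group_field_add)
  interpret A: group "AutoGroup H" by (rule H.AutoGroup)
  have "\<rho> \<in> carrier (AutoGroup H)"
    using scale_in_auto[of "\<omega> ^ 6"] gen_nonzero by (simp add: \<rho> AutoGroup_def assms(9))
  then have "subgroup K (AutoGroup H)" unfolding assms(11) by (intro A.generate_is_subgroup) simp
  then interpret G: group G unfolding assms(12) by (rule H.group_semidirect)
  have carrier_G: "carrier G = UNIV \<times> scale ` C 6 0"
    by (simp add: assms(12,9) semidirect_def K)
  have one_G: "\<one>\<^bsub>G\<^esub> = (0, scale 1)"
    by (simp only: assms(12,9) semidirect_def scale_one monoid.simps) simp
  have mult_G: "(x, scale c) \<otimes>\<^bsub>G\<^esub> (y, scale d) = (x + c * y, scale (c * d))" if "c \<noteq> 0" "d \<noteq> 0" for x y c d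
    by (simp only: assms(12,9) semidirect_def monoid.simps prod.case scale_mult[OF that])
       (simp add: scale_def)
  have W_carrier: "W \<subseteq> carrier G" by (auto simp: W carrier_G)
  have quotient: "(x, scale e) \<otimes>\<^bsub>G\<^esub> inv\<^bsub>G\<^esub> (y, scale c) = (x - e / c * y, scale (e / c))"
    if "e \<in> C 6 0" "c \<in> C 6 0" for x y e c
  proof -
    have "e / c \<in> C 6 0" using C_divide[OF six_dvd_N that] by simp
    then show ?thesis
      using that mult_G[of "e / c" c] C_nonzero[of _ 6 0]
      by (subst G.inv_solve_right') (auto simp: carrier_G)
  qed
  \<comment> \<open>For \<open>x \<noteq> 0\<close> the condition says that \<open>s\<close> lies in
    the class of \<open>x\<close>, and \<open>S\<close> meets every class in \<open>f\<close>
    elements; for \<open>x = 0\<close> the quotient is 0, which is in no class.\<close>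
  have fiber: "card {s \<in> S. x / s \<in> C 6 0} = (if x = 0 then 0 else f)" for x
  proof (cases "x = 0")
    case False
    have "card {s \<in> S. x / s \<in> C 6 0} = card {u \<in> C 6 3. u - 1 \<in> C 6 (ind x)}"
    proof (rule bij_betw_same_card[OF bij_betwI[where f = "\<lambda>s. s + 1" and g = "\<lambda>u. u - 1"]])
      have "x / s \<in> C 6 0 \<longleftrightarrow> s \<in> C 6 (ind x)" for s
      proof
        assume "s \<in> C 6 (ind x)"
        from C_divide[OF six_dvd_N C_ind[OF False] this] show "x / s \<in> C 6 0" by simp
      next
        assume *: "x / s \<in> C 6 0"
        from C_divide[OF six_dvd_N C_ind[OF False] this] C_nonzero[OF *] False
        show "s \<in> C 6 (ind x)" by simp
      qed
      then show "(\<lambda>s. s + 1) \<in> {s \<in> S. x / s \<in> C 6 0} \<rightarrow> {u \<in> C 6 3. u - 1 \<in> C 6 (ind x)}"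
        "(\<lambda>u. u - 1) \<in> {u \<in> C 6 3. u - 1 \<in> C 6 (ind x)} \<rightarrow> {s \<in> S. x / s \<in> C 6 0}"
        by (auto simp: S_iff)
    qed auto
    with False show ?thesis by (simp add: f_card)
  qed (auto simp: C_def)
  have count: "card {w \<in> W. g \<otimes>\<^bsub>G\<^esub> inv\<^bsub>G\<^esub> w \<in> W} =
      (if g = \<one>\<^bsub>G\<^esub> then 6 * f\<^sup>2 else if g \<in> W then 6 * f\<^sup>2 - f else 6 * f\<^sup>2)"
    if g: "g \<in> carrier G" for g
  proof -
    obtain h e where he: "g = (h, scale e)" "e \<in> C 6 0" using g by (auto simp: carrier_G)
    then have "e \<noteq> 0" by (simp add: C_def)
    have "card {w \<in> W. g \<otimes>\<^bsub>G\<^esub> inv\<^bsub>G\<^esub> w \<in> W} = card (SIGMA s':S. {s \<in> S. (h - s') / s \<in> C 6 0})"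
    proof (rule bij_betw_same_card[symmetric])
      \<comment> \<open>For \<open>w = (s, scale c)\<close> the first component of
        \<open>g \<otimes> inv w\<close> is \<open>s' = h - e / c * s\<close>. So \<open>s'\<close>
        and \<open>s\<close> determine \<open>c\<close>, and \<open>c\<close> lies in
        \<open>C 6 0\<close> exactly when \<open>(h - s') / s\<close> does.\<close>
      let ?j = "\<lambda>(s', s). (s, scale (e * s / (h - s')))"
      show "bij_betw ?j (SIGMA s':S. {s \<in> S. (h - s') / s \<in> C 6 0}) {w \<in> W. g \<otimes>\<^bsub>G\<^esub> inv\<^bsub>G\<^esub> w \<in> W}"
        unfolding bij_betw_def
      proof
        show "inj_on ?j (SIGMA s':S. {s \<in> S. (h - s') / s \<in> C 6 0})"
          using zero_S \<open>e \<noteq> 0\<close>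
          by (auto simp: inj_on_def scale_eq_iff C_def divide_simps split: if_splits)
        show "?j ` (SIGMA s':S. {s \<in> S. (h - s') / s \<in> C 6 0}) = {w \<in> W. g \<otimes>\<^bsub>G\<^esub> inv\<^bsub>G\<^esub> w \<in> W}"
        proof (intro equalityI subsetI)
          fix w assume "w \<in> ?j ` (SIGMA s':S. {s \<in> S. (h - s') / s \<in> C 6 0})"
          then obtain s' s where w: "w = (s, scale (e * s / (h - s')))"
            and s: "s' \<in> S" "s \<in> S" "(h - s') / s \<in> C 6 0" by auto
          have c: "e * s / (h - s') \<in> C 6 0"
            using C_divide[OF six_dvd_N he(2) s(3)] by simp
          have nz: "s \<noteq> 0" "h - s' \<noteq> 0" using s(3) by (auto simp: C_def)
          have "e / (e * s / (h - s')) = (h - s') / s"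
            using nz \<open>e \<noteq> 0\<close> by simp
          with nz s(3) have "h - e / (e * s / (h - s')) * s = s'" "e / (e * s / (h - s')) \<in> C 6 0"
            by simp_all
          then show "w \<in> {w \<in> W. g \<otimes>\<^bsub>G\<^esub> inv\<^bsub>G\<^esub> w \<in> W}"
            using s c unfolding w he(1) by (simp add: W quotient[OF he(2) c])
        next
          fix w assume "w \<in> {w \<in> W. g \<otimes>\<^bsub>G\<^esub> inv\<^bsub>G\<^esub> w \<in> W}"
          then obtain s c where w: "w = (s, scale c)" "s \<in> S" "c \<in> C 6 0"
            and gw: "g \<otimes>\<^bsub>G\<^esub> inv\<^bsub>G\<^esub> w \<in> W" by (auto simp: W)
          have "c \<noteq> 0" "s \<noteq> 0" using w zero_S by (auto simp: C_def)
          define s' where "s' = h - e / c * s"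
          have "s' \<in> S" using gw unfolding w(1) he(1) s'_def by (simp add: W quotient[OF he(2) w(3)])
          moreover have "(h - s') / s = e / c" "e * s / (h - s') = c"
            using \<open>c \<noteq> 0\<close> \<open>s \<noteq> 0\<close> \<open>e \<noteq> 0\<close> by (simp_all add: s'_def)
          moreover have "e / c \<in> C 6 0" using C_divide[OF six_dvd_N he(2) w(3)] by simp
          ultimately show "w \<in> ?j ` (SIGMA s':S. {s \<in> S. (h - s') / s \<in> C 6 0})"
            using w by (intro image_eqI[of _ _ "(s', s)"]) simp_all
        qed
      qed
    qed
    also have "\<dots> = (\<Sum>s'\<in>S. if s' = h then 0 else f)"
      by (simp add: fiber) (intro sum.cong; auto)
    also have "\<dots> = card (S - {h}) * f"
    proof -
      have "(\<Sum>s'\<in>S. if s' = h then 0 else f) = (\<Sum>s'\<in>S - {h}. f)"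
        by (rule sum.mono_neutral_cong_right) auto
      then show ?thesis by simp
    qed
    also have "\<dots> = (if h \<in> S then 6 * f\<^sup>2 - f else 6 * f\<^sup>2)"
      by (simp add: card_S card_Diff_singleton_if power2_eq_square diff_mult_distrib mult.assoc)
    \<comment> \<open>The second component of every \<open>g\<close> lies in \<open>K\<close>, so
      membership in \<open>W\<close> depends on \<open>h\<close> alone.\<close>
    also have "h \<in> S \<longleftrightarrow> g \<in> W" using he by (auto simp: W)
    finally show ?thesis using zero_S by (auto simp: one_G W)
  qed
  have "finite (carrier G)" by (simp add: carrier_G)
  moreover have "\<one>\<^bsub>G\<^esub> \<notin> W" using zero_S by (auto simp: one_G W)
  ultimately have "directed_strongly_regular (cayley G W) (card (carrier G)) (card W) (6 * f\<^sup>2 - f) (6 * f\<^sup>2) (6 * f\<^sup>2)"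
    using W_carrier count by (intro G.cayley_directed_strongly_regular)
  moreover have "card (carrier G) = q * (6 * f)"
    by (simp add: carrier_G card_cartesian_product card_K assms(1))
  moreover have "card W = 6 * f * (6 * f)"
    by (simp add: W card_cartesian_product card_S card_K)
  moreover have "real q - 1 = 36 * real f" using f \<open>q \<ge> 1\<close> unfolding N_def by linarith
  moreover have "real (6 * f\<^sup>2 - f) = 6 * (real f)\<^sup>2 - real f"
  proof -
    \<comment> \<open>This makes the natural subtraction in the parameter for adjacent vertices
      exact.\<close>
    have "f \<le> 6 * f\<^sup>2" by (simp add: power2_eq_square)
    then show ?thesis by (simp add: of_nat_diff)
  qed
  ultimately show ?thesis using W_carrier
    by (intro conjI exI[of _ "card (carrier G)"] exI[of _ "card W"] exI[of _ "6 * f\<^sup>2 - f"] exI[of _ "6 * f\<^sup>2"])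
       (simp_all add: power2_eq_square)
qed

end
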